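(* Let $\varepsilon\in\{\pm1\}$ and let $L=L(q;p_1,\ldots,p_m)$ and $L'=L(q;s_1,\ldots,s_m)$ be lens spaces. Then the following assertions are equivalent: (1) $L$ and $L'$ are $\varepsilon$-isometric. (2) There are a number $\ell\in\mathbb{Z}$, a permutation $\sigma\in S_m$ and numbers $\varepsilon_1,\ldots,\varepsilon_m\in\{\pm1\}$ such that $$\ell\, p_{\sigma(i)}\,\varepsilon_{\sigma(i)}\equiv s_i\pmod q\quad\text{for all }1\le i\le m,\qquad\text{and}\qquad \prod_{i=1}^m\varepsilon_i=\varepsilon.$$
   Context: For $q\in\mathbb{N}$ and integers $p_1,\ldots,p_m$ with $\gcd(q,p_i)=1$, let $\gamma_q^p=\gamma_q^{p_1,\ldots,p_m}\in\mathrm{SO}(2m)$ be the block diagonal matrix with $2\times2$ blocks $\begin{pmatrix}\cos(2p_i\pi/q)&\sin(2p_i\pi/q)\\-\sin(2p_i\pi/q)&\cos(2p_i\pi/q)\end{pmatrix}$, $i=1,\ldots,m$. The lens space is $L(q;p_1,\ldots,p_m)=\langle\gamma_q^p\rangle\backslash S^{2m-1}$, with the orientation and Riemannian metric induced from the round unit sphere. Two oriented Riemannian manifolds are $+1$-isometric if there is an orientation preserving isometry between them, and $-1$-isometric if there is an orientation reversing isometry between them. *)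

theory Defs
  imports "HOL-Analysis.Analysis" "HOL-Number_Theory.Cong" "HOL-Combinatorics.Permutations"
begin

section \<open>Smooth maps\<close>

text \<open>\<open>Ck_on k S f\<close>: the map \<open>f\<close> is of class $C^k$ on the open set \<open>S\<close>.\<close>

fun Ck_on :: "nat \<Rightarrow> 'a::euclidean_space set \<Rightarrow> ('a \<Rightarrow> 'b::euclidean_space) \<Rightarrow> bool" where
  "Ck_on 0 S f \<longleftrightarrow> continuous_on S f"
| "Ck_on (Suc k) S f \<longleftrightarrow>
     (\<forall>x\<in>S. f differentiable (at x)) \<and> (\<forall>v. Ck_on k S (\<lambda>x. frechet_derivative f (at x) v))"

definition smooth_on :: "'a::euclidean_space set \<Rightarrow> ('a \<Rightarrow> 'b::euclidean_space) \<Rightarrow> bool" where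
  "smooth_on S f \<longleftrightarrow> (\<forall>k. Ck_on k S f)"

section \<open>Calculus on hyperplanes\<close>

text \<open>
  The model spaces for the charts of a manifold of dimension \<open>CARD('k) - 1\<close> are the hyperplanes
  \<open>hyperplane n\<close> of \<open>real ^ 'k\<close>, where \<open>n\<close> is a unit vector. Such a hyperplane is oriented by its
  normal \<open>n\<close>: a basis $(v_1,\dots,v_d)$ of it is positive iff $(n,v_1,\dots,v_d)$ is positive.
  Using all hyperplanes rather than a fixed copy of $\mathbb{R}^d$ avoids an index type of odd
  cardinality.
\<close>

definition hyperplane :: "'e::euclidean_space \<Rightarrow> 'e set" where
  "hyperplane n = {u. u \<bullet> n = 0}"

definition hproj :: "'e::euclidean_space \<Rightarrow> 'e \<Rightarrow> 'e" where
  "hproj n x = x - (x \<bullet> n) *\<^sub>R n"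

text \<open>
  A map on a relatively open subset of \<open>hyperplane n\<close> is differentiated after extending it to be
  constant along \<open>n\<close>; on \<open>hyperplane n\<close>, the linear map \<open>hderiv n f u\<close> is the differential of \<open>f\<close>
  at \<open>u\<close>.
\<close>

definition hsmooth_on ::
  "'e::euclidean_space \<Rightarrow> 'e set \<Rightarrow> ('e \<Rightarrow> 'b::euclidean_space) \<Rightarrow> bool" where
  "hsmooth_on n W f \<longleftrightarrow> smooth_on {x. hproj n x \<in> W} (f \<circ> hproj n)"

definition hderiv ::
  "'e::euclidean_space \<Rightarrow> ('e \<Rightarrow> 'b::euclidean_space) \<Rightarrow> 'e \<Rightarrow> 'e \<Rightarrow> 'b" where
  "hderiv n f u = frechet_derivative (f \<circ> hproj n) (at u)"

text \<open>
  The sign (\<open>1\<close>, \<open>-1\<close>, or \<open>0\<close> if singular) of a linear map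
  \<open>A : hyperplane n \<rightarrow> hyperplane n'\<close> with respect to the orientations given by the normals.
\<close>

definition orientation_sign ::
  "real ^ 'k \<Rightarrow> real ^ 'k \<Rightarrow> (real ^ 'k \<Rightarrow> real ^ 'k) \<Rightarrow> real" where
  "orientation_sign n n' A = sgn (det (matrix (\<lambda>v. A (hproj n v) + (v \<bullet> n) *\<^sub>R n')))"

section \<open>Oriented Riemannian manifolds and their isometries\<close>

text \<open>
  A manifold is given by an atlas of positively oriented local parametrizations. A parametrization
  is an injective map \<open>cparam\<close> defined on the relatively open subset \<open>cdom\<close> of
  \<open>hyperplane cnormal\<close>; \<open>cgram u v w\<close> is the value of the metric tensor, in this
  parametrization, at the point with coordinates \<open>u\<close> and on the tangent vectors with
  coordinates \<open>v\<close> and \<open>w\<close>.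
\<close>

record ('a, 'e) chart =
  cnormal :: 'e
  cdom :: "'e set"
  cparam :: "'e \<Rightarrow> 'a"
  cgram :: "'e \<Rightarrow> 'e \<Rightarrow> 'e \<Rightarrow> real"

record ('a, 'e) manifold =
  points :: "'a set"
  charts :: "('a, 'e) chart set"

definition coord_dom :: "('a, 'e) chart \<Rightarrow> ('b, 'e) chart \<Rightarrow> ('a \<Rightarrow> 'b) \<Rightarrow> 'e set" where
  "coord_dom c c' F = {u \<in> cdom c. F (cparam c u) \<in> cparam c' ` cdom c'}"

definition coord_map :: "('a, 'e) chart \<Rightarrow> ('b, 'e) chart \<Rightarrow> ('a \<Rightarrow> 'b) \<Rightarrow> 'e \<Rightarrow> 'e" where
  "coord_map c c' F = inv_into (cdom c') (cparam c') \<circ> F \<circ> cparam c"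

text \<open>The openness condition expresses the continuity of \<open>F\<close>.\<close>

definition smooth_map ::
  "('a, 'e::euclidean_space) manifold \<Rightarrow> ('b, 'e) manifold \<Rightarrow> ('a \<Rightarrow> 'b) \<Rightarrow> bool" where
  "smooth_map M N F \<longleftrightarrow> F ` points M \<subseteq> points N \<and>
     (\<forall>c\<in>charts M. \<forall>c'\<in>charts N.
        openin (top_of_set (hyperplane (cnormal c))) (coord_dom c c' F) \<and>
        hsmooth_on (cnormal c) (coord_dom c c' F) (coord_map c c' F))"

definition diffeomorphism ::
  "('a, 'e::euclidean_space) manifold \<Rightarrow> ('b, 'e) manifold \<Rightarrow> ('a \<Rightarrow> 'b) \<Rightarrow> bool" where
  "diffeomorphism M N F \<longleftrightarrow> bij_betw F (points M) (points N) \<and>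
     smooth_map M N F \<and> smooth_map N M (inv_into (points M) F)"

definition riemannian_isometry ::
  "('a, 'e::euclidean_space) manifold \<Rightarrow> ('b, 'e) manifold \<Rightarrow> ('a \<Rightarrow> 'b) \<Rightarrow> bool" where
  "riemannian_isometry M N F \<longleftrightarrow> diffeomorphism M N F \<and>
     (\<forall>c\<in>charts M. \<forall>c'\<in>charts N. \<forall>u\<in>coord_dom c c' F.
        let f = coord_map c c' F; A = hderiv (cnormal c) f u in
        \<forall>v\<in>hyperplane (cnormal c). \<forall>w\<in>hyperplane (cnormal c).
          cgram c' (f u) (A v) (A w) = cgram c u v w)"

definition orientation_preserving ::
  "('a, real ^ 'k) manifold \<Rightarrow> ('b, real ^ 'k) manifold \<Rightarrow> ('a \<Rightarrow> 'b) \<Rightarrow> bool" where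
  "orientation_preserving M N F \<longleftrightarrow>
     (\<forall>c\<in>charts M. \<forall>c'\<in>charts N. \<forall>u\<in>coord_dom c c' F.
        orientation_sign (cnormal c) (cnormal c')
          (hderiv (cnormal c) (coord_map c c' F) u) = 1)"

definition orientation_reversing ::
  "('a, real ^ 'k) manifold \<Rightarrow> ('b, real ^ 'k) manifold \<Rightarrow> ('a \<Rightarrow> 'b) \<Rightarrow> bool" where
  "orientation_reversing M N F \<longleftrightarrow>
     (\<forall>c\<in>charts M. \<forall>c'\<in>charts N. \<forall>u\<in>coord_dom c c' F.
        orientation_sign (cnormal c) (cnormal c')
          (hderiv (cnormal c) (coord_map c c' F) u) = - 1)"

definition eps_isometric ::
  "int \<Rightarrow> ('a, real ^ 'k) manifold \<Rightarrow> ('b, real ^ 'k) manifold \<Rightarrow> bool" where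
  "eps_isometric \<epsilon> M N \<longleftrightarrow>
     (\<epsilon> = 1 \<and> (\<exists>F. riemannian_isometry M N F \<and> orientation_preserving M N F)) \<or>
     (\<epsilon> = - 1 \<and> (\<exists>F. riemannian_isometry M N F \<and> orientation_reversing M N F))"

section \<open>Quotients of the round unit sphere\<close>

definition orbit :: "(real ^ 'k ^ 'k) set \<Rightarrow> real ^ 'k \<Rightarrow> (real ^ 'k) set" where
  "orbit G x = (\<lambda>A. A *v x) ` G"

text \<open>
  The central projection of the tangent hyperplane $x + x^\perp$ to the unit sphere, a
  diffeomorphism onto the open hemisphere around \<open>x\<close>. It is orientation preserving if the sphere
  is oriented by its outward normal.
\<close>

definition central_proj :: "'e::euclidean_space \<Rightarrow> 'e \<Rightarrow> 'e" where
  "central_proj x u = (x + u) /\<^sub>R norm (x + u)"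

text \<open>
  The quotient of the unit sphere by a finite group \<open>G\<close> of rotations acting freely on it, with the
  smooth structure, metric and orientation for which \<open>orbit G\<close>, restricted to the sphere, is a local
  orientation preserving isometry: the parametrizations are those of the sphere followed by
  \<open>orbit G\<close>, on domains where this is injective, and the metric tensor is the pullback of the
  Euclidean inner product along the parametrization of the sphere.
\<close>

definition sphere_quotient :: "(real ^ 'k ^ 'k) set \<Rightarrow> ((real ^ 'k) set, real ^ 'k) manifold" where
  "sphere_quotient G =
     \<lparr>points = orbit G ` sphere 0 1,
      charts = {\<lparr>cnormal = x, cdom = U, cparam = orbit G \<circ> central_proj x,
                 cgram = (\<lambda>u v w. hderiv x (central_proj x) u v \<bullet> hderiv x (central_proj x) u w)\<rparr>
                | x U. x \<in> sphere 0 1 \<and> openin (top_of_set (hyperplane x)) U \<and>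
                       inj_on (orbit G \<circ> central_proj x) U}\<rparr>"

section \<open>Lens spaces\<close>

text \<open>
  The coordinates of $\mathbb{R}^{2m}$ are indexed by \<open>'m \<times> 2\<close>, with \<open>CARD('m) = m\<close>: the index
  \<open>(i, j)\<close> is the \<open>j\<close>-th coordinate of the \<open>i\<close>-th block. (The orientation of
  $\mathbb{R}^{2m}$ does not depend on the order of the blocks, as these have even size.)
\<close>

definition lens_gen :: "nat \<Rightarrow> ('m::finite \<Rightarrow> int) \<Rightarrow> real ^ ('m \<times> 2) ^ ('m \<times> 2)" where
  "lens_gen q p = (\<chi> a b.
     if fst a \<noteq> fst b then 0
     else let t = 2 * real_of_int (p (fst a)) * pi / real q in
       if snd a = snd b then cos t else if snd a = 1 then sin t else - sin t)"

inductive_set cyclic_group :: "real ^ 'k ^ 'k \<Rightarrow> (real ^ 'k ^ 'k) set" for A where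
  one: "mat 1 \<in> cyclic_group A"
| mult: "B \<in> cyclic_group A \<Longrightarrow> A ** B \<in> cyclic_group A"
| inv_mult: "B \<in> cyclic_group A \<Longrightarrow> matrix_inv A ** B \<in> cyclic_group A"

definition lens_space ::
  "nat \<Rightarrow> ('m::finite \<Rightarrow> int) \<Rightarrow> ((real ^ ('m \<times> 2)) set, real ^ ('m \<times> 2)) manifold" where
  "lens_space q p = sphere_quotient (cyclic_group (lens_gen q p))"

end

theory Submission imports Defs begin

text \<open>
A lens space is the quotient of a sphere by a finite cyclic group of rotations that acts freely, and
the theorem has a geometric and an algebraic half.

The geometric half (\<open>eps_isometric_sphere_quotients_iff\<close>) says that the isometries between the
quotients of the sphere by two finite freely acting groups \<open>H\<close> and \<open>G\<close> of rotations are exactly the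
maps induced by the orthogonal matrices \<open>Q\<close> that conjugate \<open>H\<close> onto \<open>G\<close>, and that the orientation
behaviour of the induced map is the sign of \<open>det Q\<close>. An orthogonal \<open>Q\<close> induces an isometry because
in the given charts the induced map is locally a rational map, namely an orthogonal map seen through
two central projections. Conversely, an isometry \<open>F\<close> of the quotients lifts locally to a map between
open subsets of the sphere. Extended radially, this lift becomes a map between open subsets of the
ambient Euclidean space whose derivative preserves norms (\<open>local_conical_lift\<close>); so does its local
inverse, which lifts the inverse of \<open>F\<close>. Two mutually inverse maps that do not increase distances
preserve distances, and the lift is therefore the restriction of an orthogonal matrix, unique up to
an element of \<open>G\<close>. Because of this uniqueness the class of that matrix modulo \<open>G\<close> is locally
constant along the sphere, which is connected, so one matrix describes \<open>F\<close> everywhere. The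
argument makes no use of simple connectedness and thus includes the circle.

The algebraic half decides when some \<open>Q\<close> of determinant \<open>\<epsilon>\<close> conjugates the group generated by the
block rotation with parameters \<open>p\<close> into the one with parameters \<open>s\<close>. A permutation of the blocks
composed with reflections of single blocks does so if the congruences hold, and its determinant
is the product of the signs. Conversely, \<open>Q\<close> conjugates some power \<open>l\<close> of the first generator into
the second generator. Conjugate block rotations have the same cosines with the same multiplicities
(\<open>block_rot_conjugate_imp_permuted\<close>), which yields the permutation and the signs. For \<open>q \<ge> 3\<close> the
product of these signs is \<open>det Q\<close>, because \<open>Q\<close> differs from the matrix made of the permutation and
the reflections by a matrix commuting with a block rotation without real eigenvalues; such a matrix
is complex linear for a suitable complex structure and has determinant \<open>1\<close>
(\<open>det_complex_linear_orthogonal\<close>). For \<open>q \<le> 2\<close> every number is congruent to its negative, so that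
one sign can be switched at will.
\<close>

section \<open>Orthogonal matrices\<close>

text \<open>
As a rewrite rule it would turn products of a transpose with a vector into row vector products, out
of reach of the cancellation laws below.
\<close>

declare transpose_matrix_vector [simp del]

lemma matrix_vector_inner_transpose:
  fixes A :: "real ^ 'n ^ 'n"
  shows "(A *v x) \<bullet> y = x \<bullet> (transpose A *v y)"
  by (metis dot_lmul_matrix inner_commute transpose_matrix_vector)

lemma orthogonal_matrix_cancel:
  fixes A :: "real ^ 'n ^ 'n"
  assumes "orthogonal_matrix A"
  shows "A ** transpose A = mat 1" "transpose A ** A = mat 1"
    "A *v (transpose A *v x) = x" "transpose A *v (A *v x) = x"
proof -
  show *: "A ** transpose A = mat 1" "transpose A ** A = mat 1"
    using assms by (simp_all add: orthogonal_matrix_def)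
  show "A *v (transpose A *v x) = x" "transpose A *v (A *v x) = x"
    using * by (simp_all add: matrix_vector_mul_assoc)
qed

lemma orthogonal_matrix_inner:
  fixes A :: "real ^ 'n ^ 'n"
  assumes "orthogonal_matrix A"
  shows "(A *v x) \<bullet> (A *v y) = x \<bullet> y"
  using assms by (simp add: matrix_vector_inner_transpose orthogonal_matrix_cancel)

lemma orthogonal_matrix_norm:
  fixes A :: "real ^ 'n ^ 'n"
  assumes "orthogonal_matrix A"
  shows "norm (A *v x) = norm x"
  using orthogonal_matrix_inner[OF assms] by (simp add: norm_eq_sqrt_inner)

lemma orthogonal_matrixI:
  fixes A :: "real ^ 'n ^ 'n"
  assumes "\<And>x. norm (A *v x) = norm x"
  shows "orthogonal_matrix A"
  using assms orthogonal_transformation_matrix[of "(*v) A"]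
  by (simp add: orthogonal_transformation matrix_of_matrix_vector_mul)

lemma transpose_add:
  "transpose (A + B) = transpose A + transpose (B :: 'a::comm_ring_1 ^ 'n ^ 'm)"
  by (simp add: transpose_def vec_eq_iff)

text \<open>
Because of \<open>C + 1 = C (1 + C\<^sup>T)\<close>, the determinants of \<open>C\<close> and \<open>C + 1\<close> satisfy
\<open>det (C + 1) = det C * det (C + 1)\<close>, so \<open>C + 1\<close> is singular.
\<close>

lemma orthogonal_det_minus_one_eigenvector:
  fixes C :: "real ^ 'n ^ 'n"
  assumes C: "orthogonal_matrix C" and d: "det C = -1"
  shows "\<exists>v. v \<noteq> 0 \<and> C *v v = - v"
proof -
  have "C + mat 1 = C ** (mat 1 + transpose C)"
    using C by (simp add: matrix_add_ldistrib orthogonal_matrix_def)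
  moreover have "det (mat 1 + transpose C) = det (C + mat 1)"
    by (metis add.commute det_transpose transpose_add transpose_mat)
  ultimately have "det (C + mat 1) = det C * det (C + mat 1)"
    by (metis det_mul)
  then have "det (C + mat 1) = 0"
    using d by simp
  then have "\<not> invertible (C + mat 1)"
    by (simp add: invertible_det_nz)
  then obtain v where "v \<noteq> 0" "(C + mat 1) *v v = 0"
    by (metis invertible_left_inverse matrix_left_invertible_ker)
  then show ?thesis
    by (auto simp: matrix_vector_mult_add_rdistrib eq_neg_iff_add_eq_0)
qed

lemma finite_pairwise_orthogonal_family:
  fixes v :: "'i \<Rightarrow> 'a::euclidean_space"
  assumes "\<And>i. i \<in> I \<Longrightarrow> v i \<noteq> 0"
    and "\<And>i j. i \<in> I \<Longrightarrow> j \<in> I \<Longrightarrow> i \<noteq> j \<Longrightarrow> v i \<bullet> v j = 0"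
  shows "finite I"
proof -
  have "inj_on v I"
    using assms by (metis inj_onI inner_eq_zero_iff)
  moreover have "pairwise orthogonal (v ` I)"
    using assms by (auto simp: pairwise_def orthogonal_def)
  then have "finite (v ` I)"
    using assms(1) by (intro finiteI_independent pairwise_orthogonal_independent) auto
  ultimately show ?thesis
    using finite_imageD by blast
qed

text \<open>
The matrix \<open>B\<close> is unitary for the complex structure \<open>J\<close>. If its determinant were \<open>-1\<close>, so would be
the one of \<open>B R\<close> for every \<open>R = cos t + sin t J\<close>, since \<open>R\<close> is a square. So each \<open>B R\<close>
would have the eigenvalue \<open>-1\<close>; equivalently, \<open>B\<close> would have infinitely many complex eigenvalues, and
eigenvectors of a unitary map for distinct eigenvalues are orthogonal.
\<close>

lemma det_complex_linear_orthogonal: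
  fixes B J :: "real ^ 'n ^ 'n"
  assumes B: "orthogonal_matrix B" and J: "orthogonal_matrix J"
    and J2: "\<And>v. J *v (J *v v) = - v" and comm: "\<And>v. B *v (J *v v) = J *v (B *v v)"
  shows "det B = 1"
proof (rule ccontr)
  assume "det B \<noteq> 1"
  then have dB: "det B = -1"
    using det_orthogonal_matrix[OF B] by auto
  define R where "R t = cos t *\<^sub>R mat 1 + sin t *\<^sub>R J" for t :: real
  have R: "R t *v v = cos t *\<^sub>R v + sin t *\<^sub>R (J *v v)" for t v
    by (simp add: R_def matrix_vector_mult_add_rdistrib flip: scaleR_matrix_vector_assoc)
  have Jskew: "v \<bullet> (J *v w) = - ((J *v v) \<bullet> w)" for v w
    using orthogonal_matrix_inner[OF J, of v "J *v w"] J2[of w] by simp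
  have JJ: "(J *v v) \<bullet> (J *v w) = v \<bullet> w" for v w
    by (rule orthogonal_matrix_inner[OF J])
  have Rinner: "(R t *v v) \<bullet> (R u *v w) = cos (t - u) * (v \<bullet> w) - sin (t - u) * (v \<bullet> (J *v w))" for t u v w
    by (simp add: R inner_add_left inner_add_right JJ cos_diff sin_diff Jskew[of v w] algebra_simps)
  have Rorth: "orthogonal_matrix (R t)" for t
    using Rinner[of t _ t] by (intro orthogonal_matrixI) (simp add: norm_eq_sqrt_inner)
  have Radd: "R t ** R u = R (t + u)" for t u
    by (simp add: matrix_eq R cos_add sin_add algebra_simps J2 flip: matrix_vector_mul_assoc)
  have detR: "det (R t) = 1" for t
  proof -
    have "det (R t) = det (R (t/2)) * det (R (t/2))"
      by (metis Radd det_mul field_sum_of_halves)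
    then show ?thesis
      using det_orthogonal_matrix[OF Rorth, of "t/2"] by auto
  qed
  have "\<exists>v. v \<noteq> 0 \<and> B *v (R t *v v) = - v" for t
  proof -
    have "orthogonal_matrix (B ** R t)" "det (B ** R t) = -1"
      using B Rorth dB detR by (auto simp: orthogonal_matrix_mul det_mul)
    from orthogonal_det_minus_one_eigenvector[OF this] show ?thesis
      by (simp flip: matrix_vector_mul_assoc)
  qed
  then obtain v where v0: "\<And>t. v t \<noteq> 0" and v: "\<And>t. B *v (R t *v v t) = - v t"
    by metis
  have BRinner: "(B *v (R t *v a)) \<bullet> (B *v (R u *v b)) = cos (t - u) * (a \<bullet> b) - sin (t - u) * (a \<bullet> (J *v b))" for t u a b
    by (simp add: orthogonal_matrix_inner[OF B] Rinner)
  \<comment> \<open>Angles in \<open>{0..1}\<close> differ by less than \<open>2 * pi\<close>, so their eigenvalues are distinct.\<close>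
  have "finite {0..1::real}"
  proof (rule finite_pairwise_orthogonal_family[of _ v])
    fix t u :: real
    assume tu: "t \<in> {0..1}" "u \<in> {0..1}" "t \<noteq> u"
    \<comment> \<open>With \<open>v u\<close> also \<open>J *v v u\<close> is an eigenvector, which yields a second real equation.\<close>
    have "B *v (R u *v (J *v v u)) = - (J *v v u)"
      using v[of u] by (metis R comm matrix_vector_mult_scaleR matrix_vector_right_distrib
          J2 scaleR_minus1_left)
    then have 2: "v t \<bullet> (J *v v u) = cos (t - u) * (v t \<bullet> (J *v v u)) + sin (t - u) * (v t \<bullet> v u)"
      using BRinner[of t "v t" u "J *v v u"] by (simp add: v J2)
    have 1: "v t \<bullet> v u = cos (t - u) * (v t \<bullet> v u) - sin (t - u) * (v t \<bullet> (J *v v u))"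
      using BRinner[of t "v t" u "v u"] by (simp add: v)
    have "\<bar>t - u\<bar> \<le> 1" "\<bar>t - u\<bar> > 0"
      using tu by auto
    then have "cos \<bar>t - u\<bar> < cos 0"
      using pi_gt3 by (intro cos_monotone_0_pi) auto
    then have c: "1 - cos (t - u) > 0"
      by simp
    have "(1 - cos (t - u)) * ((v t \<bullet> v u)\<^sup>2 + (v t \<bullet> (J *v v u))\<^sup>2)
        = (v t \<bullet> v u) * (v t \<bullet> v u - cos (t - u) * (v t \<bullet> v u))
        + (v t \<bullet> (J *v v u)) * (v t \<bullet> (J *v v u) - cos (t - u) * (v t \<bullet> (J *v v u)))"
      by (simp add: algebra_simps power2_eq_square)
    also have "\<dots> = (v t \<bullet> v u) * (- sin (t - u) * (v t \<bullet> (J *v v u))) + (v t \<bullet> (J *v v u)) * (sin (t - u) * (v t \<bullet> v u))"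
    proof -
      have "v t \<bullet> v u - cos (t - u) * (v t \<bullet> v u) = - sin (t - u) * (v t \<bullet> (J *v v u))"
        using 1 by linarith
      moreover have "v t \<bullet> (J *v v u) - cos (t - u) * (v t \<bullet> (J *v v u)) = sin (t - u) * (v t \<bullet> v u)"
        using 2 by linarith
      ultimately show ?thesis
        by simp
    qed
    also have "\<dots> = 0"
      by simp
    finally show "v t \<bullet> v u = 0"
      using c by (simp add: sum_power2_eq_zero_iff)
  qed (rule v0)
  then show False
    by (simp add: infinite_Icc)
qed

section \<open>Block rotations and their conjugates\<close>

text \<open>
The angles are arbitrary reals so that halving them gives a square root of the same form.
\<close>

definition block_rot :: "('m::finite \<Rightarrow> real) \<Rightarrow> real ^ ('m \<times> 2) ^ ('m \<times> 2)" where
  "block_rot \<theta> = (\<chi> a b. if fst a \<noteq> fst b then 0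
     else if snd a = snd b then cos (\<theta> (fst a))
     else if snd a = 1 then sin (\<theta> (fst a)) else - sin (\<theta> (fst a)))"

lemma sum_blocks:
  fixes f :: "'m::finite \<times> 2 \<Rightarrow> 'a::comm_monoid_add"
  shows "sum f UNIV = (\<Sum>i\<in>UNIV. f (i, 1) + f (i, 2))"
proof -
  have "sum f UNIV = (\<Sum>i\<in>UNIV. \<Sum>j\<in>UNIV. f (i, j))"
    by (simp add: sum.cartesian_product)
  then show ?thesis
    by (simp add: sum_2)
qed

lemma block_rot_entries:
  "block_rot \<theta> $ (i, 1) $ (k, 1) = (if i = k then cos (\<theta> i) else 0)"
  "block_rot \<theta> $ (i, 1) $ (k, 2) = (if i = k then sin (\<theta> i) else 0)"
  "block_rot \<theta> $ (i, 2) $ (k, 1) = (if i = k then - sin (\<theta> i) else 0)"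
  "block_rot \<theta> $ (i, 2) $ (k, 2) = (if i = k then cos (\<theta> i) else 0)"
  by (simp_all add: block_rot_def)

lemma block_rot_mult:
  "(block_rot \<theta> *v x) $ (i, 1) = cos (\<theta> i) * x $ (i, 1) + sin (\<theta> i) * x $ (i, 2)"
  "(block_rot \<theta> *v x) $ (i, 2) = - sin (\<theta> i) * x $ (i, 1) + cos (\<theta> i) * x $ (i, 2)"
  by (simp_all add: matrix_vector_mult_def sum_blocks block_rot_entries sum.distrib if_distrib[of "\<lambda>y. y * z" for z] cong: if_cong)

lemma vec_eq_blocks:
  fixes x y :: "'a ^ ('m::finite \<times> 2)"
  assumes "\<And>i. x $ (i, 1) = y $ (i, 1)" "\<And>i. x $ (i, 2) = y $ (i, 2)"
  shows "x = y"
  unfolding vec_eq_iff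
proof
  fix a :: "'m \<times> 2"
  obtain i j where "a = (i, j)"
    by fastforce
  then show "x $ a = y $ a"
    using assms exhaust_2[of j] by auto
qed

lemma block_rot_add: "block_rot \<theta> ** block_rot \<phi> = block_rot (\<lambda>i. \<theta> i + \<phi> i)"
  unfolding matrix_eq
  by (intro allI vec_eq_blocks)
    (simp_all add: block_rot_mult cos_add sin_add algebra_simps flip: matrix_vector_mul_assoc)

lemma block_rot_0: "block_rot (\<lambda>i. 0) = mat 1"
  unfolding matrix_eq
  by (intro allI vec_eq_blocks) (simp_all add: block_rot_mult)

lemma transpose_block_rot: "transpose (block_rot \<theta>) = block_rot (\<lambda>i. - \<theta> i)"
  by (intro vec_eq_blocks) (simp_all add: transpose_def block_rot_entries)

lemma orthogonal_block_rot: "orthogonal_matrix (block_rot \<theta>)"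
  unfolding orthogonal_matrix by (simp add: transpose_block_rot block_rot_add block_rot_0)

lemma det_block_rot: "det (block_rot \<theta>) = 1"
proof -
  have "block_rot \<theta> = block_rot (\<lambda>i. \<theta> i / 2) ** block_rot (\<lambda>i. \<theta> i / 2)"
    by (simp add: block_rot_add)
  then have "det (block_rot \<theta>) = det (block_rot (\<lambda>i. \<theta> i / 2)) * det (block_rot (\<lambda>i. \<theta> i / 2))"
    by (metis det_mul)
  then show ?thesis
    using det_orthogonal_matrix[OF orthogonal_block_rot, of "\<lambda>i. \<theta> i / 2"] by auto
qed

lemma block_rot_cong:
  assumes "\<And>i. cos (\<theta> i) = cos (\<phi> i)" "\<And>i. sin (\<theta> i) = sin (\<phi> i)"
  shows "block_rot \<theta> = block_rot \<phi>"
  by (intro vec_eq_blocks) (simp_all add: block_rot_entries assms)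

text \<open>
Such a matrix \<open>B\<close> is complex linear. With \<open>A\<close> the block rotation, \<open>K = A - A\<^sup>T\<close> is a
complex structure \<open>J\<close> up to the positive factors \<open>d\<close> on the blocks, written \<open>K = D J\<close>. As \<open>B\<close>
commutes with \<open>K\<close>, it commutes with \<open>D\<^sup>2 = - K\<^sup>2\<close>, hence with \<open>D\<close>, hence with \<open>J\<close>.
\<close>

lemma det_commuting_with_block_rot:
  assumes B: "orthogonal_matrix B" and comm: "B ** block_rot \<theta> = block_rot \<theta> ** B"
    and nz: "\<And>i. sin (\<theta> i) \<noteq> 0"
  shows "det B = 1"
proof -
  define A where "A = block_rot \<theta>"
  define d :: "_ \<times> 2 \<Rightarrow> real" where "d a = 2 * \<bar>sin (\<theta> (fst a))\<bar>" for a
  define D where "D x = (\<chi> a. d a * x $ a)" for x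
  define J where "J = block_rot (\<lambda>i. pi / 2 * sgn (sin (\<theta> i)))"
  define K where "K x = A *v x - transpose A *v x" for x
  have KJ: "K x = J *v D x" "J *v D x = D (J *v x)" for x
    by (rule vec_eq_blocks; force simp: K_def A_def transpose_block_rot block_rot_mult J_def D_def d_def sgn_if)+
  have BA: "B *v (A *v x) = A *v (B *v x)" for x
    using comm by (metis A_def matrix_vector_mul_assoc)
  have A: "orthogonal_matrix A"
    by (simp add: A_def orthogonal_block_rot)
  have BAt: "B *v (transpose A *v x) = transpose A *v (B *v x)" for x
    by (metis BA A orthogonal_matrix_cancel(3,4))
  have BK: "B *v K x = K (B *v x)" for x
    by (simp add: K_def BA BAt matrix_vector_mult_diff_distrib)
  have J2: "J *v (J *v x) = - x" for x
    by (rule vec_eq_blocks) (auto simp: J_def block_rot_mult sgn_if nz)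
  have "D (- x) = - D x" for x
    by (simp add: D_def vec_eq_iff)
  then have KK: "K (K x) = - D (D x)" for x
    by (simp add: KJ J2)
  have BDD: "B *v D (D x) = D (D (B *v x))" for x
  proof -
    have "B *v (- D (D x)) = - D (D (B *v x))"
      by (simp add: BK flip: KK)
    then show ?thesis
      by (metis matrix_vector_mult_scaleR minus_equation_iff scaleR_minus1_left)
  qed
  \<comment> \<open>Commuting with a diagonal matrix means vanishing at entries that join different diagonal values.\<close>
  have entries: "B $ a $ b * d b = d a * B $ a $ b" for a b
  proof -
    have "D (D (axis b 1)) = (d b * d b) *\<^sub>R axis b 1"
      by (auto simp: D_def vec_eq_iff axis_def)
    then have "(B *v D (D (axis b 1))) $ a = (d b)\<^sup>2 * B $ a $ b"
      by (simp add: matrix_vector_mult_scaleR matrix_vector_mult_basis column_def power2_eq_square)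
    moreover have "D (D (B *v axis b 1)) $ a = (d a)\<^sup>2 * B $ a $ b"
      by (simp add: D_def matrix_vector_mult_basis column_def power2_eq_square)
    ultimately have "(d b)\<^sup>2 = (d a)\<^sup>2 \<or> B $ a $ b = 0"
      using BDD[of "axis b 1"] by auto
    moreover have "d a \<ge> 0" "d b \<ge> 0"
      by (auto simp: d_def)
    ultimately show ?thesis
      by (auto simp: power2_eq_iff_nonneg)
  qed
  have BD: "B *v D x = D (B *v x)" for x
    unfolding D_def matrix_vector_mult_def vec_eq_iff vec_lambda_beta sum_distrib_left
    by (intro allI sum.cong refl) (simp only: mult.assoc[symmetric] entries)
  have "D (B *v (J *v x)) = D (J *v (B *v x))" for x
    by (metis BD BK KJ)
  moreover have "d a \<noteq> 0" for a
    by (simp add: d_def nz)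
  ultimately have BJ: "B *v (J *v x) = J *v (B *v x)" for x
    by (simp add: D_def vec_eq_iff)
  show ?thesis
    by (rule det_complex_linear_orthogonal[OF B _ J2 BJ]) (simp add: J_def orthogonal_block_rot)
qed

definition block_perm :: "('m \<Rightarrow> 'm) \<Rightarrow> real ^ ('m::finite \<times> 2) ^ ('m \<times> 2)" where
  "block_perm \<sigma> = (\<chi> a b. if b = (\<sigma> (fst a), snd a) then 1 else 0)"

text \<open>
Only the second coordinate of each block is multiplied, so that the determinant is the product of the
factors.
\<close>

definition block_refl :: "('m \<Rightarrow> int) \<Rightarrow> real ^ ('m::finite \<times> 2) ^ ('m \<times> 2)" where
  "block_refl e = (\<chi> a b. if a = b then if snd a = 1 then 1 else real_of_int (e (fst a)) else 0)"

lemma block_perm_mult: "(block_perm \<sigma> *v x) $ (i, j) = x $ (\<sigma> i, j)"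
  by (simp add: matrix_vector_mult_def block_perm_def if_distrib[of "\<lambda>y. y * z" for z] cong: if_cong)

lemma block_refl_mult:
  "(block_refl e *v x) $ (i, 1) = x $ (i, 1)"
  "(block_refl e *v x) $ (i, 2) = real_of_int (e i) * x $ (i, 2)"
  by (simp_all add: matrix_vector_mult_def block_refl_def if_distrib[of "\<lambda>y. y * z" for z] cong: if_cong)

lemma orthogonal_block_perm:
  assumes "\<sigma> permutes UNIV"
  shows "orthogonal_matrix (block_perm \<sigma>)"
proof (rule orthogonal_matrixI)
  fix x :: "real ^ ('a \<times> 2)"
  have "(\<Sum>i\<in>UNIV. (x $ (\<sigma> i, 1))\<^sup>2 + (x $ (\<sigma> i, 2))\<^sup>2) = (\<Sum>i\<in>UNIV. (x $ (i, 1))\<^sup>2 + (x $ (i, 2))\<^sup>2)"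
    using sum.permute[OF assms, of "\<lambda>i. (x $ (i, 1))\<^sup>2 + (x $ (i, 2))\<^sup>2"] by (simp add: o_def)
  then show "norm (block_perm \<sigma> *v x) = norm x"
    by (simp add: norm_vec_def L2_set_def sum_blocks block_perm_mult)
qed

text \<open>
Permuting whole blocks is complex linear when each block is regarded as a complex line.
\<close>

lemma det_block_perm:
  assumes "\<sigma> permutes UNIV"
  shows "det (block_perm \<sigma>) = 1"
proof (rule det_complex_linear_orthogonal[OF orthogonal_block_perm[OF assms] orthogonal_block_rot])
  fix v :: "real ^ ('a \<times> 2)"
  show "block_rot (\<lambda>i. pi / 2) *v (block_rot (\<lambda>i. pi / 2) *v v) = - v"
    by (rule vec_eq_blocks) (simp_all add: block_rot_mult)
  show "block_perm \<sigma> *v (block_rot (\<lambda>i. pi / 2) *v v) = block_rot (\<lambda>i. pi / 2) *v (block_perm \<sigma> *v v)"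
    by (rule vec_eq_blocks) (simp_all add: block_rot_mult block_perm_mult)
qed

lemma det_block_refl: "det (block_refl e) = real_of_int (\<Prod>i\<in>UNIV. e i)"
proof -
  have "det (block_refl e) = (\<Prod>a\<in>UNIV. block_refl e $ a $ a)"
    by (rule det_diagonal) (simp add: block_refl_def)
  also have "\<dots> = (\<Prod>i\<in>UNIV. \<Prod>j\<in>UNIV. block_refl e $ (i, j) $ (i, j))"
    by (simp add: prod.cartesian_product)
  also have "\<dots> = real_of_int (\<Prod>i\<in>UNIV. e i)"
    by (simp add: UNIV_2 block_refl_def)
  finally show ?thesis .
qed

lemma orthogonal_block_refl:
  assumes "\<And>i. e i \<in> {1, - 1}"
  shows "orthogonal_matrix (block_refl e)"
proof (rule orthogonal_matrixI)
  fix x :: "real ^ ('a \<times> 2)"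
  have "(real_of_int (e i) * y)\<^sup>2 = y\<^sup>2" for i y
    using assms[of i] by auto
  then show "norm (block_refl e *v x) = norm x"
    by (simp add: norm_vec_def L2_set_def sum_blocks block_refl_mult)
qed

text \<open>
Reflecting a block reverses its angle of rotation.
\<close>

lemma block_perm_refl_conjugates:
  assumes "\<And>i. cos (\<phi> i) = cos (\<theta> (\<sigma> i))" "\<And>i. sin (\<phi> i) = real_of_int (e (\<sigma> i)) * sin (\<theta> (\<sigma> i))"
    and e: "\<And>i. e i \<in> {1, - 1}"
  shows "block_rot \<phi> ** (block_perm \<sigma> ** block_refl e) = (block_perm \<sigma> ** block_refl e) ** block_rot \<theta>"
proof -
  have "e i = 1 \<or> e i = -1" for i
    using e by auto
  then have ee: "real_of_int (e i) * (real_of_int (e i) * y) = y" for i y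
    by (metis minus_minus mult_minus1 of_int_1 of_int_minus mult_1)
  show ?thesis
    unfolding matrix_eq
    by (intro allI vec_eq_blocks)
      (simp_all add: block_rot_mult block_perm_mult block_refl_mult assms(1,2) distrib_left right_diff_distrib ee mult.assoc mult.left_commute[of "sin _"] flip: matrix_vector_mul_assoc)
qed

text \<open>
The sum of a block rotation and its transpose is diagonal with entries \<open>2 cos (\<theta> i)\<close>, each occurring
twice. Conjugate rotations thus give eigenspaces \<open>E\<close> of equal dimension, which counts the blocks
with a given cosine.
\<close>

lemma block_rot_conjugate_imp_permuted:
  assumes Q: "orthogonal_matrix Q" and conj: "Q ** block_rot \<theta> = block_rot \<phi> ** Q"
  obtains \<sigma> where "\<sigma> permutes UNIV" "\<And>i. cos (\<phi> i) = cos (\<theta> (\<sigma> i))"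
proof -
  define E where "E \<theta> c = {x :: real ^ ('a \<times> 2). \<forall>a. a \<notin> {a. cos (\<theta> (fst a)) = c} \<longrightarrow> x $ a = 0}" for \<theta> :: "'a \<Rightarrow> real" and c
  have E: "x \<in> E \<theta> c \<longleftrightarrow> block_rot \<theta> *v x + transpose (block_rot \<theta>) *v x = (2 * c) *\<^sub>R x" for x c and \<theta> :: "'a \<Rightarrow> real"
  proof -
    have "block_rot \<theta> *v x + transpose (block_rot \<theta>) *v x = (\<chi> a. 2 * cos (\<theta> (fst a)) * x $ a)"
      by (rule vec_eq_blocks) (simp_all add: transpose_block_rot block_rot_mult)
    then show ?thesis
      by (auto simp: E_def vec_eq_iff)
  qed
  have c1: "Q *v (block_rot \<theta> *v x) = block_rot \<phi> *v (Q *v x)" for x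
    using conj by (metis matrix_vector_mul_assoc)
  have c2: "Q *v (transpose (block_rot \<theta>) *v x) = transpose (block_rot \<phi>) *v (Q *v x)" for x
    by (metis c1 orthogonal_block_rot orthogonal_matrix_cancel(3,4))
  have inj: "inj ((*v) Q)"
    by (metis Q injI orthogonal_matrix_cancel(4))
  have QE: "Q *v x \<in> E \<phi> c \<longleftrightarrow> x \<in> E \<theta> c" for x c
  proof -
    have "Q *v x \<in> E \<phi> c \<longleftrightarrow> Q *v (block_rot \<theta> *v x + transpose (block_rot \<theta>) *v x) = Q *v ((2 * c) *\<^sub>R x)"
      by (simp add: E c1 c2 matrix_vector_right_distrib matrix_vector_mult_scaleR)
    also have "\<dots> \<longleftrightarrow> x \<in> E \<theta> c"
      using inj by (simp add: E inj_eq)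
    finally show ?thesis .
  qed
  have "(*v) Q ` E \<theta> c = E \<phi> c" for c
    using QE orthogonal_matrix_cancel(3)[OF Q] by (auto simp: image_iff) metis
  then have "dim (E \<phi> c) = dim (E \<theta> c)" for c
    by (metis dim_image_eq inj inj_on_subset matrix_vector_mul_linear subset_UNIV)
  moreover have "dim (E \<theta> c) = 2 * card {i. cos (\<theta> i) = c}" for c and \<theta> :: "'a \<Rightarrow> real"
  proof -
    have "dim (E \<theta> c) = card {a :: 'a \<times> 2. cos (\<theta> (fst a)) = c}"
      using dim_substandard_cart[of "{a :: 'a \<times> 2. cos (\<theta> (fst a)) = c}", where 'a = real]
      by (simp add: E_def dim_vec_eq)
    also have "{a :: 'a \<times> 2. cos (\<theta> (fst a)) = c} = {i. cos (\<theta> i) = c} \<times> UNIV"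
      by auto
    finally show ?thesis
      by (simp add: card_cartesian_product)
  qed
  ultimately have card: "card {i. c = cos (\<phi> i)} = card {i. c = cos (\<theta> i)}" for c
    by (simp add: eq_commute[of c])
  have "image_mset (\<lambda>i. cos (\<phi> i)) (mset_set UNIV) = image_mset (\<lambda>i. cos (\<theta> i)) (mset_set UNIV)"
    by (rule multiset_eqI) (simp add: count_image_mset' card)
  from image_mset_eq_implies_permutes[OF finite_class.finite_UNIV this] show ?thesis
    using that by auto
qed

section \<open>Lens space groups up to conjugation\<close>

definition lens_angle :: "nat \<Rightarrow> int \<Rightarrow> real" where
  "lens_angle q a = 2 * real_of_int a * pi / real q"

lemma lens_gen_eq_block_rot: "lens_gen q p = block_rot (\<lambda>i. lens_angle q (p i))"
  unfolding lens_gen_def block_rot_def lens_angle_def Let_def ..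

lemma lens_angle_add: "lens_angle q (a + b) = lens_angle q a + lens_angle q b"
  and lens_angle_minus: "lens_angle q (- a) = - lens_angle q a"
  and lens_angle_0: "lens_angle q 0 = 0"
  by (simp_all add: lens_angle_def field_simps add_divide_distrib)

lemma cos_lens_angle_eq_iff:
  assumes "q \<ge> 1"
  shows "cos (lens_angle q a) = cos (lens_angle q b) \<longleftrightarrow> [a = b] (mod int q) \<or> [a = - b] (mod int q)"
proof -
  have *: "lens_angle q a = lens_angle q b + 2 * real_of_int n * pi \<longleftrightarrow> a = b + n * int q" for a b n
  proof -
    have "lens_angle q a = lens_angle q b + 2 * real_of_int n * pi \<longleftrightarrow> 2 * pi * real_of_int a = 2 * pi * real_of_int (b + n * int q)"
      using assms by (simp add: lens_angle_def field_simps)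
    also have "\<dots> \<longleftrightarrow> a = b + n * int q"
      by (metis mult_cancel_left of_int_eq_iff pi_neq_zero zero_neq_numeral mult_eq_0_iff)
    finally show ?thesis .
  qed
  have **: "(\<exists>n. a = b + n * int q) \<longleftrightarrow> [a = b] (mod int q)" for a b
    by (metis cong_iff_lin cong_sym mult.commute)
  have "cos (lens_angle q a) = cos (lens_angle q b) \<longleftrightarrow>
      (\<exists>n. lens_angle q a = lens_angle q b + 2 * real_of_int n * pi
        \<or> lens_angle q a = lens_angle q (- b) + 2 * real_of_int n * pi)"
    by (auto simp: cos_eq Ints_def lens_angle_minus)
  also have "\<dots> \<longleftrightarrow> (\<exists>n. a = b + n * int q) \<or> (\<exists>n. a = - b + n * int q)"
    by (simp only: * ex_disj_distrib)
  finally show ?thesis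
    by (simp only: **)
qed

lemma lens_angle_cong:
  assumes "q \<ge> 1" "[a = b] (mod int q)"
  shows "cos (lens_angle q a) = cos (lens_angle q b)" "sin (lens_angle q a) = sin (lens_angle q b)"
proof -
  obtain n where "a = b + int q * n"
    using assms(2) by (metis cong_iff_lin cong_sym)
  then have *: "lens_angle q a = lens_angle q b + 2 * pi * real_of_int n"
    using assms(1) by (simp add: lens_angle_def field_simps)
  show "cos (lens_angle q a) = cos (lens_angle q b)" "sin (lens_angle q a) = sin (lens_angle q b)"
    unfolding * by (simp_all add: sin_add cos_add)
qed

lemma sin_lens_angle_nonzero:
  assumes "q \<ge> 3" "coprime a (int q)"
  shows "sin (lens_angle q a) \<noteq> 0"
proof
  assume "sin (lens_angle q a) = 0"
  then obtain i where "lens_angle q a = real_of_int i * pi"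
    by (auto simp: sin_zero_iff_int2)
  then have "pi * real_of_int (2 * a) = pi * real_of_int (i * int q)"
    using assms(1) by (simp add: lens_angle_def field_simps)
  then have "2 * a = i * int q"
    by (metis mult_cancel_left of_int_eq_iff pi_neq_zero)
  then have "int q dvd 2"
    using assms(2) by (metis coprime_commute coprime_dvd_mult_left_iff dvd_triv_right)
  then show False
    using assms(1) by (auto dest!: zdvd_imp_le)
qed

text \<open>
The groups whose sphere quotients are oriented manifolds: freeness makes the orbit map a local
diffeomorphism, and determinant \<open>1\<close> lets the orientation descend.
\<close>

locale free_rotation_group =
  fixes G :: "(real ^ 'k ^ 'k) set"
  assumes finite: "finite G"
    and one: "mat 1 \<in> G"
    and mult: "A \<in> G \<Longrightarrow> B \<in> G \<Longrightarrow> A ** B \<in> G"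
    and transpose: "A \<in> G \<Longrightarrow> transpose A \<in> G"
    and orth: "A \<in> G \<Longrightarrow> orthogonal_matrix A"
    and det: "A \<in> G \<Longrightarrow> det A = 1"
    and free: "A \<in> G \<Longrightarrow> A *v x = x \<Longrightarrow> x \<noteq> 0 \<Longrightarrow> A = mat 1"

lemma lens_gen_mult: "lens_gen q a ** lens_gen q b = lens_gen q (\<lambda>i. a i + b i)"
  by (simp add: lens_gen_eq_block_rot block_rot_add lens_angle_add)

lemma lens_gen_0: "lens_gen q (\<lambda>i. 0) = mat 1"
  by (simp add: lens_gen_eq_block_rot lens_angle_0 block_rot_0)

lemma transpose_lens_gen: "transpose (lens_gen q a) = lens_gen q (\<lambda>i. - a i)"
  by (simp add: lens_gen_eq_block_rot transpose_block_rot lens_angle_minus)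

lemma orthogonal_lens_gen: "orthogonal_matrix (lens_gen q a)"
  by (simp add: lens_gen_eq_block_rot orthogonal_block_rot)

lemma lens_gen_cong:
  assumes "q \<ge> 1" "\<And>i. [a i = b i] (mod int q)"
  shows "lens_gen q a = lens_gen q b"
  unfolding lens_gen_eq_block_rot using assms by (intro block_rot_cong lens_angle_cong)

lemma matrix_inv_orthogonal:
  fixes A :: "real ^ 'n ^ 'n"
  assumes "orthogonal_matrix A"
  shows "matrix_inv A = transpose A"
proof -
  have "A ** matrix_inv A = mat 1 \<and> matrix_inv A ** A = mat 1"
    unfolding matrix_inv_def
    by (rule someI[of _ "transpose A"]) (simp add: orthogonal_matrix_cancel[OF assms])
  then have "matrix_inv A ** (A ** transpose A) = transpose A"
    by (simp add: matrix_mul_assoc)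
  then show ?thesis
    by (simp add: orthogonal_matrix_cancel[OF assms])
qed

lemma cyclic_group_lens_gen:
  "cyclic_group (lens_gen q p) = range (\<lambda>k::int. lens_gen q (\<lambda>i. k * p i))"
proof -
  let ?G = "cyclic_group (lens_gen q p)"
  have "A \<in> range (\<lambda>k::int. lens_gen q (\<lambda>i. k * p i))" if "A \<in> ?G" for A
    using that
  proof induction
    case one
    then show ?case
      by (intro range_eqI[of _ _ 0]) (simp add: lens_gen_0)
  next
    case (mult B)
    then obtain k where "B = lens_gen q (\<lambda>i. k * p i)"
      by blast
    then show ?case
      by (intro range_eqI[of _ _ "k + 1"]) (simp add: lens_gen_mult algebra_simps)
  next
    case (inv_mult B)
    then obtain k where "B = lens_gen q (\<lambda>i. k * p i)"
      by blast
    then show ?case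
      by (intro range_eqI[of _ _ "k - 1"])
        (simp add: lens_gen_mult matrix_inv_orthogonal orthogonal_lens_gen transpose_lens_gen algebra_simps)
  qed
  moreover have "lens_gen q (\<lambda>i. k * p i) \<in> ?G" for k
  proof (induction k rule: int_induct[of _ 0])
    case base
    then show ?case
      using cyclic_group.one[of "lens_gen q p"] by (simp add: lens_gen_0)
  next
    case (step1 k)
    then show ?case
      using cyclic_group.mult[of "lens_gen q (\<lambda>i. k * p i)" "lens_gen q p"]
      by (simp add: lens_gen_mult algebra_simps)
  next
    case (step2 k)
    then show ?case
      using cyclic_group.inv_mult[of "lens_gen q (\<lambda>i. k * p i)" "lens_gen q p"]
      by (simp add: lens_gen_mult matrix_inv_orthogonal orthogonal_lens_gen transpose_lens_gen algebra_simps)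
  qed
  ultimately show ?thesis
    by blast
qed

text \<open>
A nonzero fixed vector of the power \<open>k\<close> has a nonzero component in some block \<open>i\<close>, on which the
rotation must then be trivial. So \<open>q\<close> divides \<open>k * p i\<close>, hence \<open>k\<close>, since \<open>p i\<close> is a unit modulo \<open>q\<close>.
\<close>

lemma lens_group_free:
  fixes p :: "'m::finite \<Rightarrow> int"
  assumes q: "q \<ge> 1" and p: "\<And>i. gcd (int q) (p i) = 1"
  shows "free_rotation_group (cyclic_group (lens_gen q p))"
proof
  let ?G = "cyclic_group (lens_gen q p)"
  note G = cyclic_group_lens_gen[of q p]
  show "finite ?G"
  proof (rule finite_subset)
    show "?G \<subseteq> (\<lambda>k. lens_gen q (\<lambda>i. k * p i)) ` {0..<int q}"
    proof
      fix A assume "A \<in> ?G"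
      then obtain k where "A = lens_gen q (\<lambda>i. k * p i)"
        using G by blast
      also have "\<dots> = lens_gen q (\<lambda>i. (k mod int q) * p i)"
        by (intro lens_gen_cong q) (simp add: cong_def mod_mult_left_eq)
      finally show "A \<in> (\<lambda>k. lens_gen q (\<lambda>i. k * p i)) ` {0..<int q}"
        using q by auto
    qed
  qed simp
  show "mat 1 \<in> ?G"
    by (rule cyclic_group.one)
  show "A ** B \<in> ?G" if AB: "A \<in> ?G" "B \<in> ?G" for A B
  proof -
    obtain j k where "A = lens_gen q (\<lambda>i. j * p i)" "B = lens_gen q (\<lambda>i. k * p i)"
      using G AB by blast
    then have "A ** B = lens_gen q (\<lambda>i. (j + k) * p i)"
      by (simp add: lens_gen_mult algebra_simps)
    then show ?thesis
      unfolding G by blast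
  qed
  fix A assume "A \<in> ?G"
  then obtain k where A: "A = lens_gen q (\<lambda>i. k * p i)"
    using G by blast
  have "transpose A = lens_gen q (\<lambda>i. (- k) * p i)"
    by (simp add: A transpose_lens_gen)
  then show "transpose A \<in> ?G"
    unfolding G by blast
  show "orthogonal_matrix A"
    by (simp add: A orthogonal_lens_gen)
  show "det A = 1"
    by (simp add: A lens_gen_eq_block_rot det_block_rot)
  fix x assume fx: "A *v x = x" and "x \<noteq> 0"
  then obtain i where i: "x $ (i, 1) \<noteq> 0 \<or> x $ (i, 2) \<noteq> 0"
    using vec_eq_blocks[of x 0] by auto
  define t where "t = lens_angle q (k * p i)"
  have 1: "x $ (i, 1) = cos t * x $ (i, 1) + sin t * x $ (i, 2)"
    and 2: "x $ (i, 2) = - sin t * x $ (i, 1) + cos t * x $ (i, 2)"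
    using fx block_rot_mult[of "\<lambda>i. lens_angle q (k * p i)" x i] by (simp_all add: A lens_gen_eq_block_rot t_def)
  have "(1 - cos t) * ((x $ (i, 1))\<^sup>2 + (x $ (i, 2))\<^sup>2)
      = x $ (i, 1) * (x $ (i, 1) - cos t * x $ (i, 1)) + x $ (i, 2) * (x $ (i, 2) - cos t * x $ (i, 2))"
    by (simp add: algebra_simps power2_eq_square)
  also have "x $ (i, 1) - cos t * x $ (i, 1) = sin t * x $ (i, 2)"
    using 1 by linarith
  also have "x $ (i, 2) - cos t * x $ (i, 2) = - sin t * x $ (i, 1)"
    using 2 by linarith
  finally have "(1 - cos t) * ((x $ (i, 1))\<^sup>2 + (x $ (i, 2))\<^sup>2) = 0"
    by simp
  then have "cos t = cos (lens_angle q 0)"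
    using i by (auto simp: lens_angle_0 sum_power2_eq_zero_iff)
  then have "[k * p i = 0] (mod int q)"
    using cos_lens_angle_eq_iff[OF q, of "k * p i" 0] by (simp add: t_def)
  then have "int q dvd k * p i"
    by (simp add: cong_0_iff)
  then have "int q dvd k"
    using p[of i] by (metis coprime_dvd_mult_left_iff coprime_iff_gcd_eq_1)
  then have "A = lens_gen q (\<lambda>i. 0)"
    unfolding A by (intro lens_gen_cong q) (simp add: cong_0_iff)
  then show "A = mat 1"
    by (simp add: lens_gen_0)
qed

lemma orthogonal_conjugation_iff:
  fixes Q A B :: "real ^ 'n ^ 'n"
  assumes "orthogonal_matrix Q"
  shows "Q ** A ** transpose Q = B \<longleftrightarrow> Q ** A = B ** Q"
  by (metis assms matrix_mul_assoc matrix_mul_rid orthogonal_matrix_cancel(1,2))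

lemma orthogonal_intertwiner_transpose:
  fixes R A B :: "real ^ 'n ^ 'n"
  assumes R: "orthogonal_matrix R" and "A ** R = R ** B"
  shows "transpose R ** A = B ** transpose R"
proof -
  have "transpose R ** A = transpose R ** (A ** R) ** transpose R"
    by (simp add: orthogonal_matrix_cancel[OF R] flip: matrix_mul_assoc)
  also have "\<dots> = (transpose R ** R) ** B ** transpose R"
    by (simp add: assms(2) matrix_mul_assoc)
  also have "\<dots> = B ** transpose R"
    by (simp add: orthogonal_matrix_cancel[OF R])
  finally show ?thesis .
qed

text \<open>
The matrix permutes the blocks by \<open>\<sigma>\<close> and reflects those with sign \<open>-1\<close>. It maps one group onto the
other, and not just into it, because the congruences force \<open>l\<close> to be a unit modulo \<open>q\<close>.
\<close>

lemma lens_congruences_imp_conjugate: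
  fixes p s :: "'m::finite \<Rightarrow> int"
  assumes q: "q \<ge> 1" and s: "\<And>i. gcd (int q) (s i) = 1"
    and \<sigma>: "\<sigma> permutes UNIV" and e: "\<And>i. e i \<in> {1, - 1}"
    and cong: "\<And>i. [l * p (\<sigma> i) * e (\<sigma> i) = s i] (mod int q)"
  shows "\<exists>Q. orthogonal_matrix Q \<and> det Q = real_of_int (\<Prod>i\<in>UNIV. e i) \<and>
    (\<lambda>A. Q ** A ** transpose Q) ` cyclic_group (lens_gen q p) = cyclic_group (lens_gen q s)"
proof (intro exI conjI)
  let ?Q = "block_perm \<sigma> ** block_refl e"
  have ee: "e i = 1 \<or> e i = -1" for i
    using e by auto
  show Q: "orthogonal_matrix ?Q"
    by (intro orthogonal_matrix_mul orthogonal_block_perm orthogonal_block_refl \<sigma> e)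
  show "det ?Q = real_of_int (\<Prod>i\<in>UNIV. e i)"
    by (simp add: det_mul det_block_perm \<sigma> det_block_refl)
  have conj: "?Q ** lens_gen q a ** transpose ?Q = lens_gen q b"
    if "\<And>i. [b i = a (\<sigma> i) * e (\<sigma> i)] (mod int q)" for a b
  proof -
    have "cos (lens_angle q (b i)) = cos (lens_angle q (a (\<sigma> i))) \<and>
        sin (lens_angle q (b i)) = real_of_int (e (\<sigma> i)) * sin (lens_angle q (a (\<sigma> i)))" for i
      using ee[of "\<sigma> i"] lens_angle_cong[OF q that[of i]] by (auto simp: lens_angle_minus)
    then show ?thesis
      unfolding orthogonal_conjugation_iff[OF Q] lens_gen_eq_block_rot
      by (intro block_perm_refl_conjugates[symmetric] e) auto
  qed
  have "coprime l (int q)"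
  proof -
    have "coprime (l * (p (\<sigma> i) * e (\<sigma> i))) (int q)" for i
      using s[of i] cong[of i] by (metis cong_imp_coprime cong_sym coprime_commute coprime_iff_gcd_eq_1 mult.assoc)
    then show ?thesis
      by (simp add: coprime_mult_left_iff)
  qed
  then obtain l' where l': "[l * l' = 1] (mod int q)"
    by (metis cong_solve_coprime_int)
  show "(\<lambda>A. ?Q ** A ** transpose ?Q) ` cyclic_group (lens_gen q p) = cyclic_group (lens_gen q s)"
  proof (intro equalityI subsetI)
    fix B assume "B \<in> (\<lambda>A. ?Q ** A ** transpose ?Q) ` cyclic_group (lens_gen q p)"
    then obtain k where B: "B = ?Q ** lens_gen q (\<lambda>i. k * p i) ** transpose ?Q"
      by (auto simp: cyclic_group_lens_gen)
    have "B = lens_gen q (\<lambda>i. (k * l') * s i)"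
      unfolding B
    proof (rule conj)
      fix i
      have "[k * l' * s i = k * l' * (l * p (\<sigma> i) * e (\<sigma> i))] (mod int q)"
        by (intro cong_mult cong_refl cong_sym[OF cong])
      also have "k * l' * (l * p (\<sigma> i) * e (\<sigma> i)) = (l * l') * (k * p (\<sigma> i) * e (\<sigma> i))"
        by simp
      also have "[\<dots> = 1 * (k * p (\<sigma> i) * e (\<sigma> i))] (mod int q)"
        by (intro cong_mult cong_refl l')
      finally show "[k * l' * s i = k * p (\<sigma> i) * e (\<sigma> i)] (mod int q)"
        by simp
    qed
    then show "B \<in> cyclic_group (lens_gen q s)"
      by (auto simp: cyclic_group_lens_gen)
  next
    fix B assume "B \<in> cyclic_group (lens_gen q s)"
    then obtain k where B: "B = lens_gen q (\<lambda>i. k * s i)"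
      by (auto simp: cyclic_group_lens_gen)
    have "?Q ** lens_gen q (\<lambda>i. (k * l) * p i) ** transpose ?Q = B"
      unfolding B
    proof (rule conj)
      fix i
      have "[k * s i = k * (l * p (\<sigma> i) * e (\<sigma> i))] (mod int q)"
        by (intro cong_mult cong_refl cong_sym[OF cong])
      then show "[k * s i = k * l * p (\<sigma> i) * e (\<sigma> i)] (mod int q)"
        by (simp add: mult.assoc)
    qed
    then show "B \<in> (\<lambda>A. ?Q ** A ** transpose ?Q) ` cyclic_group (lens_gen q p)"
      by (force simp: cyclic_group_lens_gen)
  qed
qed

text \<open>
The generator for \<open>s\<close> is conjugate to a power \<open>l\<close> of the one for \<open>p\<close>, and comparing cosines gives \<open>\<sigma>\<close>
and the signs up to the condition on their product. For \<open>q \<ge> 3\<close> that condition holds because the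
quotient of \<open>Q\<close> and the standard matrix for \<open>\<sigma>\<close> and \<open>e\<close> commutes with a block rotation without real
eigenvalues. For \<open>q \<le> 2\<close> the signs do not matter modulo \<open>q\<close> and one of them can be switched.
\<close>

lemma conjugate_imp_lens_congruences:
  fixes p s :: "'m::finite \<Rightarrow> int"
  assumes q: "q \<ge> 1" and s: "\<And>i. gcd (int q) (s i) = 1"
    and Q: "orthogonal_matrix Q"
    and conj: "(\<lambda>A. Q ** A ** transpose Q) ` cyclic_group (lens_gen q p) = cyclic_group (lens_gen q s)"
  shows "\<exists>l \<sigma> e. \<sigma> permutes UNIV \<and> (\<forall>i. e i \<in> {1, - 1}) \<and>
    (\<forall>i. [l * p (\<sigma> i) * e (\<sigma> i) = s i] (mod int q)) \<and> det Q = real_of_int (\<Prod>i\<in>UNIV. e i)"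
proof -
  have "lens_gen q s \<in> cyclic_group (lens_gen q s)"
    unfolding cyclic_group_lens_gen by (rule range_eqI[of _ _ 1]) simp
  then have "lens_gen q s \<in> (\<lambda>A. Q ** A ** transpose Q) ` cyclic_group (lens_gen q p)"
    by (simp add: conj)
  then obtain l where "lens_gen q s = Q ** lens_gen q (\<lambda>i. l * p i) ** transpose Q"
    unfolding cyclic_group_lens_gen by blast
  then have l: "Q ** lens_gen q (\<lambda>i. l * p i) = lens_gen q s ** Q"
    by (metis Q orthogonal_conjugation_iff)
  then obtain \<sigma> where \<sigma>: "\<sigma> permutes UNIV"
    and "\<And>i. cos (lens_angle q (s i)) = cos (lens_angle q (l * p (\<sigma> i)))"
    using block_rot_conjugate_imp_permuted[OF Q] unfolding lens_gen_eq_block_rot by blast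
  then have pm: "[s i = l * p (\<sigma> i)] (mod int q) \<or> [s i = - (l * p (\<sigma> i))] (mod int q)" for i
    by (simp add: cos_lens_angle_eq_iff[OF q])
  define e :: "'m \<Rightarrow> int" where "e j = (if [s (inv \<sigma> j) = l * p j] (mod int q) then 1 else - 1)" for j
  have e: "e j \<in> {1, - 1}" for j
    by (simp add: e_def)
  have cong: "[l * p (\<sigma> i) * e (\<sigma> i) = s i] (mod int q)" for i
    using pm[of i] by (auto simp: e_def permutes_inverses(2)[OF \<sigma>] cong_sym)
  have detQ: "det Q = 1 \<or> det Q = -1"
    by (rule det_orthogonal_matrix[OF Q])
  have prode: "(\<Prod>i\<in>I. e i) = 1 \<or> (\<Prod>i\<in>I. e i) = -1" if "finite I" for I
    using that
  proof induction
    case (insert j I)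
    have "e j = 1 \<or> e j = - 1"
      using e[of j] by simp
    then show ?case
      using insert by auto
  qed simp
  show ?thesis
  proof (cases "q \<ge> 3")
    case True
    let ?R = "block_perm \<sigma> ** block_refl e"
    have R: "orthogonal_matrix ?R"
      by (intro orthogonal_matrix_mul orthogonal_block_perm orthogonal_block_refl \<sigma> e)
    have ee: "e i = 1 \<or> e i = -1" for i
      using e[of i] by auto
    have "cos (lens_angle q (s i)) = cos (lens_angle q (l * p (\<sigma> i))) \<and>
        sin (lens_angle q (s i)) = real_of_int (e (\<sigma> i)) * sin (lens_angle q (l * p (\<sigma> i)))" for i
      using ee[of "\<sigma> i"] lens_angle_cong[OF q cong[of i]] by (auto simp: lens_angle_minus)
    then have RA: "lens_gen q s ** ?R = ?R ** lens_gen q (\<lambda>i. l * p i)"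
      unfolding lens_gen_eq_block_rot by (intro block_perm_refl_conjugates e) auto
    have "(transpose ?R ** Q) ** lens_gen q (\<lambda>i. l * p i) = lens_gen q (\<lambda>i. l * p i) ** (transpose ?R ** Q)"
    proof -
      have "transpose ?R ** lens_gen q s = lens_gen q (\<lambda>i. l * p i) ** transpose ?R"
        using R RA by (rule orthogonal_intertwiner_transpose)
      then show ?thesis
        using l by (simp add: matrix_mul_assoc[symmetric]) (simp add: matrix_mul_assoc)
    qed
    moreover have "sin (lens_angle q (l * p j)) \<noteq> 0" for j
    proof -
      obtain i where "j = \<sigma> i"
        by (metis \<sigma> permutes_inverses(1))
      then have "coprime (l * p j * e j) (int q)"
        using s[of i] cong[of i] by (metis cong_imp_coprime cong_sym coprime_commute coprime_iff_gcd_eq_1)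
      then have "coprime (l * p j) (int q)"
        by (simp add: coprime_mult_left_iff)
      with True show ?thesis
        by (rule sin_lens_angle_nonzero)
    qed
    ultimately have "det (transpose ?R ** Q) = 1"
      unfolding lens_gen_eq_block_rot
      using R Q by (intro det_commuting_with_block_rot orthogonal_matrix_mul) auto
    then have "det ?R * det Q = 1"
      by (simp add: det_mul det_transpose)
    then have "det Q = det ?R"
      using det_orthogonal_matrix[OF R] detQ by auto
    then have "det Q = real_of_int (\<Prod>i\<in>UNIV. e i)"
      by (simp add: det_mul det_block_perm \<sigma> det_block_refl)
    then show ?thesis
      using \<sigma> e cong by blast
  next
    case False
    then have "q = 1 \<or> q = 2"
      using q by auto
    \<comment> \<open>The number \<open>2 * x\<close> is divisible by \<open>q\<close>.\<close>
    then have neg: "[x = - x] (mod int q)" for x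
      by (auto simp: cong_iff_dvd_diff)
    show ?thesis
    proof (cases "det Q = real_of_int (\<Prod>i\<in>UNIV. e i)")
      case True
      then show ?thesis
        using \<sigma> e cong by blast
    next
      case F: False
      obtain i0 :: 'm where True
        by simp
      define e' where "e' = e(i0 := - e i0)"
      have "(\<Prod>i\<in>UNIV. e' i) = - (\<Prod>i\<in>UNIV. e i)"
        by (simp add: prod.remove[of UNIV i0] e'_def)
      then have "det Q = real_of_int (\<Prod>i\<in>UNIV. e' i)"
        using F detQ prode[of UNIV] by (auto simp del: of_int_prod)
      moreover have "[l * p (\<sigma> i) * e' (\<sigma> i) = s i] (mod int q)" for i
        using cong[of i] neg[of "l * p i0 * e i0"] by (auto simp: e'_def intro: cong_trans cong_sym)
      moreover have "e' i \<in> {1, - 1}" for i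
        using e[of i] e[of i0] by (auto simp: e'_def)
      ultimately show ?thesis
        using \<sigma> by blast
    qed
  qed
qed

section \<open>Smoothness of rational maps\<close>

text \<open>
Inverses are taken only of functions without zeros on \<open>S\<close>, so that all members are differentiable on \<open>S\<close>
and the class is closed under directional derivatives.
\<close>

inductive_set rational_functions :: "'a::euclidean_space set \<Rightarrow> ('a \<Rightarrow> real) set"
  for S where
  const: "(\<lambda>x. c) \<in> rational_functions S"
| inner: "(\<lambda>x. x \<bullet> a) \<in> rational_functions S"
| add: "f \<in> rational_functions S \<Longrightarrow> g \<in> rational_functions S \<Longrightarrow> (\<lambda>x. f x + g x) \<in> rational_functions S"
| mult: "f \<in> rational_functions S \<Longrightarrow> g \<in> rational_functions S \<Longrightarrow> (\<lambda>x. f x * g x) \<in> rational_functions S"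
| inverse: "f \<in> rational_functions S \<Longrightarrow> (\<And>x. x \<in> S \<Longrightarrow> f x \<noteq> 0) \<Longrightarrow> (\<lambda>x. inverse (f x)) \<in> rational_functions S"

lemma rational_function_derivative:
  assumes "f \<in> rational_functions S"
  shows "\<exists>f'. (\<forall>x\<in>S. (f has_derivative f' x) (at x)) \<and> (\<forall>v. (\<lambda>x. f' x v) \<in> rational_functions S)"
  using assms
proof induction
  case (const c)
  then show ?case
    by (intro exI[of _ "\<lambda>x v. 0"]) (auto intro: rational_functions.const)
next
  case (inner a)
  then show ?case
    by (intro exI[of _ "\<lambda>x v. v \<bullet> a"])
      (auto intro: rational_functions.const bounded_linear_imp_has_derivative bounded_linear_inner_left)
next
  case (add f g)
  then obtain f' g' where "\<And>x. x \<in> S \<Longrightarrow> (f has_derivative f' x) (at x)" "\<And>v. (\<lambda>x. f' x v) \<in> rational_functions S"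
    "\<And>x. x \<in> S \<Longrightarrow> (g has_derivative g' x) (at x)" "\<And>v. (\<lambda>x. g' x v) \<in> rational_functions S"
    by blast
  then show ?case
    by (intro exI[of _ "\<lambda>x v. f' x v + g' x v"]) (auto intro: rational_functions.add has_derivative_add)
next
  case (mult f g)
  then obtain f' g' where "\<And>x. x \<in> S \<Longrightarrow> (f has_derivative f' x) (at x)" "\<And>v. (\<lambda>x. f' x v) \<in> rational_functions S"
    "\<And>x. x \<in> S \<Longrightarrow> (g has_derivative g' x) (at x)" "\<And>v. (\<lambda>x. g' x v) \<in> rational_functions S"
    by blast
  moreover from this have "(\<lambda>x. f x * g' x v + f' x v * g x) \<in> rational_functions S" for v
    using mult.hyps by (intro rational_functions.add rational_functions.mult)
  ultimately show ?case
    by (intro exI[of _ "\<lambda>x v. f x * g' x v + f' x v * g x"]) (auto intro: has_derivative_mult)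
next
  case (inverse f)
  then obtain f' where f': "\<And>x. x \<in> S \<Longrightarrow> (f has_derivative f' x) (at x)" "\<And>v. (\<lambda>x. f' x v) \<in> rational_functions S"
    by blast
  have "(\<lambda>x. - 1 * (inverse (f x) * f' x v * inverse (f x))) \<in> rational_functions S" for v
    using inverse f'
    by (intro rational_functions.mult rational_functions.inverse rational_functions.const) auto
  moreover have "((\<lambda>x. inverse (f x)) has_derivative (\<lambda>v. - (inverse (f x) * f' x v * inverse (f x)))) (at x)"
    if "x \<in> S" for x
    using that inverse f' by (intro Deriv.has_derivative_inverse) auto
  ultimately show ?case
    by (intro exI[of _ "\<lambda>x v. - (inverse (f x) * f' x v * inverse (f x))"]) auto
qed

text \<open>
Being locally rational passes to directional derivatives, so all orders of differentiability follow by
induction.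
\<close>

lemma smooth_on_if_locally_rational:
  fixes f :: "'a::euclidean_space \<Rightarrow> 'b::euclidean_space"
  assumes "\<And>x. x \<in> S \<Longrightarrow> \<exists>T g. open T \<and> x \<in> T \<and> (\<forall>b\<in>Basis. (\<lambda>y. g y \<bullet> b) \<in> rational_functions T) \<and> (\<forall>y\<in>T. f y = g y)"
  shows "smooth_on S f"
proof -
  have deriv: "\<exists>T g'. open T \<and> x \<in> T \<and> (\<forall>v. \<forall>b\<in>Basis. (\<lambda>y. g' y v \<bullet> b) \<in> rational_functions T) \<and>
      (\<forall>y\<in>T. (f has_derivative g' y) (at y))"
    if ex: "\<exists>T g. open T \<and> x \<in> T \<and> (\<forall>b\<in>Basis. (\<lambda>y. g y \<bullet> b) \<in> rational_functions T) \<and> (\<forall>y\<in>T. f y = g y)"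
    for x and f :: "'a \<Rightarrow> 'b"
  proof -
    obtain T g where *: "open T \<and> x \<in> T \<and> (\<forall>b\<in>Basis. (\<lambda>y. g y \<bullet> b) \<in> rational_functions T) \<and> (\<forall>y\<in>T. f y = g y)"
      using ex by blast
    then have T: "open T" "x \<in> T" and g: "\<And>b. b \<in> Basis \<Longrightarrow> (\<lambda>y. g y \<bullet> b) \<in> rational_functions T"
      and fg: "\<And>y. y \<in> T \<Longrightarrow> f y = g y"
      by auto
    have "\<forall>b\<in>Basis. \<exists>g'. (\<forall>y\<in>T. ((\<lambda>y. g y \<bullet> b) has_derivative g' y) (at y)) \<and> (\<forall>v. (\<lambda>y. g' y v) \<in> rational_functions T)"
      using g by (intro ballI rational_function_derivative)
    then obtain h where h: "\<And>b y. b \<in> Basis \<Longrightarrow> y \<in> T \<Longrightarrow> ((\<lambda>y. g y \<bullet> b) has_derivative h b y) (at y)"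
      "\<And>b v. b \<in> Basis \<Longrightarrow> (\<lambda>y. h b y v) \<in> rational_functions T"
      unfolding bchoice_iff by blast
    define g' where "g' y v = (\<Sum>b\<in>Basis. h b y v *\<^sub>R b)" for y v
    have g'b: "g' y v \<bullet> b = h b y v" if "b \<in> Basis" for y v b
      using that by (simp add: g'_def)
    have "(g has_derivative g' y) (at y)" if "y \<in> T" for y
      using h(1) that by (subst has_derivative_componentwise_within) (simp add: g'b)
    then have "(f has_derivative g' y) (at y)" if "y \<in> T" for y
      using that T(1) fg by (intro has_derivative_transform_within_open[of g "g' y" y UNIV T f]) auto
    then show ?thesis
      using T h(2) by (intro exI[of _ T] exI[of _ g']) (simp add: g'b)
  qed
  have "Ck_on k S f" for k
    using assms
  proof (induction k arbitrary: f)
    case 0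
    have "isCont f x" if "x \<in> S" for x
      using deriv[OF 0[OF that]] has_derivative_continuous by blast
    then show ?case
      by (simp add: continuous_at_imp_continuous_on)
  next
    case (Suc k)
    have diff: "f differentiable (at x)" if "x \<in> S" for x
      using deriv[OF Suc.prems[OF that]] differentiableI by blast
    have "Ck_on k S (\<lambda>x. frechet_derivative f (at x) v)" for v
    proof (rule Suc.IH)
      fix x assume "x \<in> S"
      from deriv[OF Suc.prems[OF this]] obtain T g' where T: "open T" "x \<in> T"
        "\<And>v b. b \<in> Basis \<Longrightarrow> (\<lambda>y. g' y v \<bullet> b) \<in> rational_functions T"
        "\<And>y. y \<in> T \<Longrightarrow> (f has_derivative g' y) (at y)"
        by blast
      then have "frechet_derivative f (at y) = g' y" if "y \<in> T" for y
        using that frechet_derivative_at by metis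
      with T show "\<exists>T g. open T \<and> x \<in> T \<and> (\<forall>b\<in>Basis. (\<lambda>y. g y \<bullet> b) \<in> rational_functions T) \<and>
          (\<forall>y\<in>T. frechet_derivative f (at y) v = g y)"
        by (intro exI[of _ T] exI[of _ "\<lambda>y. g' y v"]) auto
    qed
    then show ?case
      using diff by simp
  qed
  then show ?thesis
    by (simp add: smooth_on_def)
qed

section \<open>Central projection\<close>

lemma hproj_in_hyperplane: "norm x = 1 \<Longrightarrow> hproj x z \<in> hyperplane x"
  by (simp add: hproj_def hyperplane_def inner_diff_left dot_square_norm)

lemma hproj_ident: "u \<in> hyperplane x \<Longrightarrow> hproj x u = u"
  by (simp add: hproj_def hyperplane_def)

lemma bounded_linear_hproj: "bounded_linear (hproj x)"
  unfolding hproj_def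
  by (intro bounded_linear_sub bounded_linear_ident bounded_linear_compose[OF bounded_linear_scaleR_left] bounded_linear_inner_left)

lemma hproj_has_derivative: "(hproj x has_derivative hproj x) (at z)"
  by (rule bounded_linear_imp_has_derivative[OF bounded_linear_hproj])

lemma continuous_hproj: "continuous_on S (hproj x)"
  by (rule bounded_linear.continuous_on[OF bounded_linear_hproj continuous_on_id])

text \<open>
The inverse of \<open>central_proj x\<close>, extended to be constant along lines through the origin. It does not involve the norm and is
therefore rational, unlike \<open>central_proj x\<close> itself.
\<close>

definition gnomonic :: "'e::euclidean_space \<Rightarrow> 'e \<Rightarrow> 'e" where
  "gnomonic x y = y /\<^sub>R (y \<bullet> x) - x"

lemma gnomonic_in_hyperplane: "norm x = 1 \<Longrightarrow> y \<bullet> x \<noteq> 0 \<Longrightarrow> gnomonic x y \<in> hyperplane x"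
  by (simp add: gnomonic_def hyperplane_def inner_diff_left dot_square_norm)

lemma gnomonic_scaleR: "c \<noteq> 0 \<Longrightarrow> gnomonic x (c *\<^sub>R y) = gnomonic x y"
  by (simp add: gnomonic_def)

lemma central_proj_eq_sgn: "central_proj x u = sgn (x + u)"
  by (simp add: central_proj_def sgn_div_norm)

lemma hyperplane_shift_inner: "norm x = 1 \<Longrightarrow> u \<in> hyperplane x \<Longrightarrow> (x + u) \<bullet> x = 1"
  by (simp add: hyperplane_def inner_add_left dot_square_norm)

lemma hyperplane_shift_nonzero: "norm x = 1 \<Longrightarrow> u \<in> hyperplane x \<Longrightarrow> x + u \<noteq> 0"
  using hyperplane_shift_inner by fastforce

lemma norm_central_proj: "norm x = 1 \<Longrightarrow> u \<in> hyperplane x \<Longrightarrow> norm (central_proj x u) = 1"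
  by (simp add: central_proj_eq_sgn norm_sgn hyperplane_shift_nonzero)

lemma gnomonic_shift: "norm x = 1 \<Longrightarrow> u \<in> hyperplane x \<Longrightarrow> gnomonic x (x + u) = u"
  by (simp add: gnomonic_def hyperplane_shift_inner)

lemma gnomonic_central_proj: "norm x = 1 \<Longrightarrow> u \<in> hyperplane x \<Longrightarrow> gnomonic x (central_proj x u) = u"
  by (simp add: central_proj_def gnomonic_scaleR gnomonic_shift hyperplane_shift_nonzero)

lemma central_proj_gnomonic:
  assumes "0 < y \<bullet> x"
  shows "central_proj x (gnomonic x y) = sgn y"
proof -
  have "x + gnomonic x y = inverse (y \<bullet> x) *\<^sub>R y"
    by (simp add: gnomonic_def)
  then show ?thesis
    using assms by (simp add: central_proj_eq_sgn sgn_scaleR)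
qed

lemma central_proj_inner_pos: "norm x = 1 \<Longrightarrow> u \<in> hyperplane x \<Longrightarrow> 0 < central_proj x u \<bullet> x"
  by (simp add: central_proj_def hyperplane_shift_inner hyperplane_shift_nonzero)

lemma central_proj_0: "norm x = 1 \<Longrightarrow> central_proj x 0 = x"
  by (simp add: central_proj_def)

lemma sgn_orthogonal_matrix: "orthogonal_matrix B \<Longrightarrow> sgn (B *v y) = B *v sgn y" for B :: "real ^ 'n ^ 'n"
  by (simp add: sgn_div_norm orthogonal_matrix_norm matrix_vector_mult_scaleR)

definition gnomonic_deriv :: "'e::euclidean_space \<Rightarrow> 'e \<Rightarrow> 'e \<Rightarrow> 'e" where
  "gnomonic_deriv x y h = h /\<^sub>R (y \<bullet> x) - ((h \<bullet> x) / (y \<bullet> x)\<^sup>2) *\<^sub>R y"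

lemma gnomonic_has_derivative:
  assumes "y \<bullet> x \<noteq> 0"
  shows "(gnomonic x has_derivative gnomonic_deriv x y) (at y)"
  unfolding gnomonic_def gnomonic_deriv_def[abs_def]
  by (rule derivative_eq_intros refl assms | simp add: power2_eq_square divide_simps assms)+

lemma isCont_gnomonic: "y \<bullet> x \<noteq> 0 \<Longrightarrow> isCont (gnomonic x) y"
  using gnomonic_has_derivative has_derivative_continuous by blast

lemma central_proj_hproj_differentiable:
  assumes "norm x = 1"
  shows "(central_proj x \<circ> hproj x) differentiable (at u)"
proof -
  have nz: "x + hproj x u \<noteq> 0"
    using assms hyperplane_shift_nonzero hproj_in_hyperplane by blast
  have d: "(\<lambda>z. x + hproj x z) differentiable (at u)"
    using hproj_has_derivative by (intro differentiable_add differentiable_const) (auto simp: differentiable_def)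
  have "norm differentiable (at (x + hproj x u))"
    using nz by simp
  then have "(\<lambda>z. norm (x + hproj x z)) differentiable (at u)"
    using d by (rule differentiable_compose)
  then show ?thesis
    unfolding o_def central_proj_def using d nz by (intro differentiable_scaleR differentiable_inverse) auto
qed

section \<open>Orientation in central projections\<close>

lemma linear_shear: "linear (\<lambda>v. v + (v \<bullet> a) *\<^sub>R c)"
  by (rule linearI) (simp_all add: algebra_simps inner_add_left)

text \<open>
A shear is invertible, and it is the square of the shear with half the parameter.
\<close>

lemma det_shear_pos:
  fixes a c :: "real ^ 'n"
  assumes "a \<bullet> c = 0"
  shows "0 < det (matrix (\<lambda>v. v + (v \<bullet> a) *\<^sub>R c))"
proof -
  define S where "S t = matrix (\<lambda>v. v + (t * (v \<bullet> a)) *\<^sub>R c)" for t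
  have S: "S t *v v = v + (t * (v \<bullet> a)) *\<^sub>R c" for t v
  proof -
    have "linear (\<lambda>v. v + (t * (v \<bullet> a)) *\<^sub>R c)"
      by (rule linearI) (simp_all add: algebra_simps inner_add_left)
    then show ?thesis
      by (simp add: S_def matrix_works)
  qed
  have mult: "S t ** S u = S (t + u)" for t u
    using assms by (simp add: matrix_eq S inner_add_left inner_commute algebra_simps flip: matrix_vector_mul_assoc)
  have "S 0 = mat 1"
    by (simp add: matrix_eq S)
  then have "det (S 1) * det (S (- 1)) = 1"
    using mult[of 1 "- 1"] by (metis add.right_inverse det_I det_mul)
  moreover have "det (S 1) = (det (S (1/2)))\<^sup>2"
    using mult[of "1/2" "1/2"] by (simp add: power2_eq_square flip: det_mul)
  ultimately have "det (S 1) > 0"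
    by (metis mult_zero_left zero_less_power2 power_zero_numeral zero_neq_one)
  then show ?thesis
    by (simp add: S_def)
qed

text \<open>
Let \<open>M\<close> be the matrix whose determinant defines the sign, \<open>y = B (x + u)\<close> and \<open>s = y \<bullet> x'\<close>. The
shear \<open>P\<close> moves \<open>x\<close> to \<open>x + u\<close>, and the shear \<open>N\<close> scaled by \<open>1 / s\<close> moves \<open>y\<close> to \<open>x'\<close>; so \<open>(1 / s) N B P\<close>
and \<open>M\<close> agree on \<open>x\<close>. On the hyperplane they agree modulo \<open>x'\<close>, which is repaired by a shear \<open>R\<close> in
the source. All factors other than \<open>B\<close> have positive determinant.
\<close>

lemma orientation_sign_gnomonic:
  fixes B :: "real ^ 'k ^ 'k"
  assumes B: "orthogonal_matrix B" and x: "norm x = 1" and x': "norm x' = 1"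
    and u: "u \<in> hyperplane x" and s: "0 < (B *v (x + u)) \<bullet> x'"
  shows "orientation_sign x x' (\<lambda>v. gnomonic_deriv x' (B *v (x + u)) (B *v hproj x v)) = det B"
proof -
  define y where "y = B *v (x + u)"
  define s where "s = y \<bullet> x'"
  have s0: "s > 0"
    using s by (simp add: s_def y_def)
  have xx: "x \<bullet> x = 1" "x' \<bullet> x' = 1" and ux: "u \<bullet> x = 0"
    using x x' u by (simp_all add: dot_square_norm hyperplane_def)
  define A where "A v = (B *v v) /\<^sub>R s - (((B *v v) \<bullet> x') / s\<^sup>2) *\<^sub>R y" for v
  define M where "M v = A (hproj x v) + (v \<bullet> x) *\<^sub>R x'" for v
  define b where "b = hproj x (transpose B *v x') /\<^sub>R s"
  define P where "P v = v + (v \<bullet> x) *\<^sub>R u" for v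
  define R where "R v = v + (v \<bullet> b) *\<^sub>R x" for v
  define N where "N v = v + (v \<bullet> x') *\<^sub>R (x' - (1 / s) *\<^sub>R y)" for v
  have linhproj: "linear (hproj x)"
    by (rule bounded_linear.linear[OF bounded_linear_hproj])
  have linA: "linear A"
  proof -
    have "A = (\<lambda>v. (B *v v) /\<^sub>R s - (v \<bullet> ((transpose B *v x') /\<^sub>R s\<^sup>2)) *\<^sub>R y)"
      by (simp add: A_def fun_eq_iff matrix_vector_inner_transpose divide_inverse mult.commute)
    then show ?thesis
      by (auto intro!: linearI simp: algebra_simps inner_add_left)
  qed
  have linM: "linear M"
    unfolding M_def using linA linhproj
    by (intro linear_compose_add linear_compose[of "hproj x" A, unfolded o_def]) (auto intro!: linearI simp: algebra_simps inner_add_left)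
  have linP: "linear P" and linR: "linear R" and linN: "linear N"
    unfolding P_def R_def N_def by (rule linear_shear)+
  have bx: "b \<bullet> x = 0"
    using hproj_in_hyperplane[OF x] by (simp add: b_def hyperplane_def)
  have vb: "v \<bullet> b = ((B *v hproj x v) \<bullet> x') / s" for v
  proof -
    have "v \<bullet> hproj x c = hproj x v \<bullet> c" for c
      by (simp add: hproj_def inner_diff_left inner_diff_right inner_commute)
    then show ?thesis
      by (simp add: b_def matrix_vector_inner_transpose divide_inverse)
  qed
  have key: "(1 / s) *\<^sub>R N (B *v P v) = M (R v)" for v
  proof -
    define w where "w = hproj x v"
    define a where "a = v \<bullet> x"
    have v: "v = w + a *\<^sub>R x"
      by (simp add: w_def a_def hproj_def)
    have "P v = v + a *\<^sub>R u"
      by (simp add: P_def a_def)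
    also have "\<dots> = w + a *\<^sub>R (x + u)"
      by (subst v) (simp add: scaleR_add_right)
    finally have BP: "B *v P v = B *v w + a *\<^sub>R y"
      by (simp add: y_def matrix_vector_right_distrib matrix_vector_mult_scaleR)
    have "R v \<bullet> x = a + v \<bullet> b"
      by (simp add: R_def inner_add_left xx a_def)
    moreover have "hproj x (R v) = w"
      by (simp add: hproj_def R_def inner_add_left xx w_def algebra_simps)
    ultimately have "M (R v) = A w + (a + ((B *v w) \<bullet> x') / s) *\<^sub>R x'"
      by (simp add: M_def vb w_def)
    moreover have "(1 / s) *\<^sub>R N (B *v w + a *\<^sub>R y) = A w + (a + ((B *v w) \<bullet> x') / s) *\<^sub>R x'"
    proof -
      define k c where "k = B *v w" and "c = k \<bullet> x'"
      have "(k + a *\<^sub>R y) \<bullet> x' = c + a * s"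
        by (simp add: inner_add_left s_def c_def)
      moreover have "(c + a * s) *\<^sub>R (x' - (1 / s) *\<^sub>R y) = (c + a * s) *\<^sub>R x' - (c / s + a) *\<^sub>R y"
      proof -
        have eq: "(c + a * s) * (1 / s) = c / s + a"
          using s0 by (simp add: field_simps)
        show ?thesis
          by (simp only: scaleR_diff_right scaleR_scaleR eq)
      qed
      ultimately have "N (k + a *\<^sub>R y) = k - (c / s) *\<^sub>R y + (c + a * s) *\<^sub>R x'"
        by (simp add: N_def scaleR_add_left)
      moreover have "1 / s * (c / s) = c / s\<^sup>2" "1 / s * (c + a * s) = a + c / s"
        using s0 by (simp_all add: field_simps power2_eq_square)
      ultimately have "(1 / s) *\<^sub>R N (k + a *\<^sub>R y) = (1 / s) *\<^sub>R k - (c / s\<^sup>2) *\<^sub>R y + (a + c / s) *\<^sub>R x'"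
        by (simp only: scaleR_add_right scaleR_diff_right scaleR_scaleR)
      then show ?thesis
        by (simp add: A_def k_def c_def divide_inverse)
    qed
    ultimately show ?thesis
      by (simp add: BP)
  qed
  have "matrix ((*\<^sub>R) (1 / s)) ** (matrix N ** (B ** matrix P)) = matrix M ** matrix R"
    unfolding matrix_eq
    by (auto simp: matrix_works linM linN linP linR key linear_scale_self simp flip: matrix_vector_mul_assoc)
  then have "det (matrix ((*\<^sub>R) (1 / s)) :: real ^ 'k ^ 'k) * (det (matrix N) * (det B * det (matrix P))) = det (matrix M) * det (matrix R)"
    by (metis det_mul)
  then have "sgn (det (matrix ((*\<^sub>R) (1 / s)) :: real ^ 'k ^ 'k)) * (sgn (det (matrix N)) * (sgn (det B) * sgn (det (matrix P))))
      = sgn (det (matrix M)) * sgn (det (matrix R))"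
    by (metis sgn_mult)
  moreover have "det (matrix N) > 0" "det (matrix P) > 0" "det (matrix R) > 0"
  proof -
    have "x' \<bullet> y = s"
      by (simp add: s_def inner_commute)
    then have "x' \<bullet> (x' - (1 / s) *\<^sub>R y) = 0"
      using s0 by (simp add: inner_diff_right xx)
    then show "det (matrix N) > 0" "det (matrix P) > 0" "det (matrix R) > 0"
      unfolding N_def P_def R_def using ux bx by (auto intro!: det_shear_pos simp: inner_commute)
  qed
  moreover have "det (matrix ((*\<^sub>R) (1 / s)) :: real ^ 'k ^ 'k) > 0"
    using s0 by simp
  ultimately have "sgn (det B) = sgn (det (matrix M))"
    by (simp only: sgn_pos mult_1 mult_1_right)
  moreover have "sgn (det B) = det B"
    using det_orthogonal_matrix[OF B] by auto
  moreover have "hproj x (hproj x v) = hproj x v" for v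
    by (simp add: hproj_ident hproj_in_hyperplane x)
  ultimately show ?thesis
    by (simp add: orientation_sign_def M_def[abs_def] A_def s_def y_def gnomonic_deriv_def)
qed

section \<open>Isometries induced by orthogonal matrices\<close>

definition sphere_chart ::
  "(real ^ 'k ^ 'k) set \<Rightarrow> real ^ 'k \<Rightarrow> (real ^ 'k) set \<Rightarrow> ((real ^ 'k) set, real ^ 'k) chart" where
  "sphere_chart G x U = \<lparr>cnormal = x, cdom = U, cparam = orbit G \<circ> central_proj x,
     cgram = (\<lambda>u v w. hderiv x (central_proj x) u v \<bullet> hderiv x (central_proj x) u w)\<rparr>"

lemma sphere_chart_simps [simp]:
  "cnormal (sphere_chart G x U) = x"
  "cdom (sphere_chart G x U) = U"
  "cparam (sphere_chart G x U) = orbit G \<circ> central_proj x"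
  "cgram (sphere_chart G x U) u v w = hderiv x (central_proj x) u v \<bullet> hderiv x (central_proj x) u w"
  by (simp_all add: sphere_chart_def)

lemma points_sphere_quotient: "points (sphere_quotient G) = orbit G ` sphere 0 1"
  by (simp add: sphere_quotient_def)

definition chart_domain :: "(real ^ 'k ^ 'k) set \<Rightarrow> real ^ 'k \<Rightarrow> (real ^ 'k) set \<Rightarrow> bool" where
  "chart_domain G x U \<longleftrightarrow> norm x = 1 \<and> openin (top_of_set (hyperplane x)) U \<and> inj_on (orbit G \<circ> central_proj x) U"

lemma charts_sphere_quotient: "charts (sphere_quotient G) = {sphere_chart G x U | x U. chart_domain G x U}"
  by (auto simp: sphere_quotient_def sphere_chart_def chart_domain_def)

lemma chart_domain_subset: "chart_domain G x U \<Longrightarrow> u \<in> U \<Longrightarrow> u \<in> hyperplane x"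
  unfolding chart_domain_def by (meson openin_imp_subset subsetD topspace_euclidean_subtopology)

context free_rotation_group
begin

lemma orbit_self: "x \<in> orbit G x"
  unfolding orbit_def using one by (rule rev_image_eqI) simp

lemma orbit_eqD: "orbit G x = orbit G y \<Longrightarrow> \<exists>g\<in>G. y = g *v x"
  using orbit_self[of y] by (auto simp: orbit_def)

lemma orbit_move:
  assumes "g \<in> G"
  shows "orbit G (g *v x) = orbit G x"
proof -
  have "h *v (g *v x) \<in> orbit G x" if "h \<in> G" for h
    using mult[OF that assms] by (auto simp: orbit_def matrix_vector_mul_assoc)
  moreover have "h *v x \<in> orbit G (g *v x)" if "h \<in> G" for h
  proof -
    have "h *v x = (h ** transpose g) *v (g *v x)"
      using orthogonal_matrix_cancel(4)[OF orth[OF assms]] by (simp flip: matrix_vector_mul_assoc)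
    then show ?thesis
      using mult[OF that transpose[OF assms]] by (auto simp: orbit_def)
  qed
  ultimately show ?thesis
    by (auto simp: orbit_def)
qed

text \<open>
The point with coordinates \<open>u0\<close> is mapped into the image of the chart at \<open>x'\<close>, so some element \<open>g\<close> of
the group moves its image under \<open>Q\<close> into the domain of that chart on the sphere. By continuity the
same \<open>g\<close> serves for all points nearby.
\<close>

lemma coord_map_locally_gnomonic:
  assumes Q: "orthogonal_matrix Q" and F: "\<And>y. norm y = 1 \<Longrightarrow> F (orbit H y) = orbit G (Q *v y)"
    and U: "chart_domain H x U" and U': "chart_domain G x' U'"
    and u0: "u0 \<in> coord_dom (sphere_chart H x U) (sphere_chart G x' U') F"
  obtains T g where "open T" "u0 \<in> T" "g \<in> G"
    "\<And>u. u \<in> T \<Longrightarrow> u \<in> hyperplane x \<Longrightarrow> u \<in> coord_dom (sphere_chart H x U) (sphere_chart G x' U') F"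
    "\<And>u. u \<in> T \<Longrightarrow> 0 < ((g ** Q) *v (x + u)) \<bullet> x'"
    "\<And>u. u \<in> T \<Longrightarrow> u \<in> hyperplane x \<Longrightarrow>
      coord_map (sphere_chart H x U) (sphere_chart G x' U') F u = gnomonic x' ((g ** Q) *v (x + u))"
proof -
  have x: "norm x = 1" and x': "norm x' = 1" and inj: "inj_on (orbit G \<circ> central_proj x') U'"
    using U U' by (auto simp: chart_domain_def)
  obtain T1 where T1: "open T1" "U = hyperplane x \<inter> T1"
    using U by (auto simp: chart_domain_def openin_open)
  obtain T2 where T2: "open T2" "U' = hyperplane x' \<inter> T2"
    using U' by (auto simp: chart_domain_def openin_open)
  have u0U: "u0 \<in> U" and u0x: "u0 \<in> hyperplane x"
    using u0 T1 by (auto simp: coord_dom_def)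
  obtain w where w: "w \<in> U'" "F (orbit H (central_proj x u0)) = orbit G (central_proj x' w)"
    using u0 by (auto simp: coord_dom_def)
  have wx': "w \<in> hyperplane x'"
    using w T2 by blast
  have "orbit G (Q *v central_proj x u0) = orbit G (central_proj x' w)"
    using w F norm_central_proj[OF x u0x] by simp
  then obtain g where g: "g \<in> G" "central_proj x' w = g *v (Q *v central_proj x u0)"
    using orbit_eqD by blast
  define B where "B = g ** Q"
  have B: "orthogonal_matrix B"
    unfolding B_def using Q orth[OF g(1)] by (simp add: orthogonal_matrix_mul)
  define \<phi> where "\<phi> u = gnomonic x' (B *v (x + u))" for u
  define P where "P = {u. 0 < (B *v (x + u)) \<bullet> x'}"
  have contB: "continuous_on S (\<lambda>u. B *v (x + u))" for S
    by (intro continuous_on_compose2[OF matrix_vector_mult_linear_continuous_on[of UNIV B]] continuous_intros) auto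
  have "open P"
    unfolding P_def by (intro open_Collect_less continuous_intros contB)
  moreover have "continuous_on P \<phi>"
    unfolding \<phi>_def
    by (rule continuous_on_compose2[OF _ contB[of P], of "{y. 0 < y \<bullet> x'}"])
      (auto simp: P_def intro!: continuous_at_imp_continuous_on isCont_gnomonic)
  ultimately have "open (P \<inter> \<phi> -` T2)"
    using T2(1) by (intro continuous_open_preimage)
  define T where "T = T1 \<inter> (P \<inter> \<phi> -` T2)"
  have T: "open T"
    unfolding T_def using T1(1) \<open>open (P \<inter> \<phi> -` T2)\<close> by blast
  have Bu0: "B *v (x + u0) = norm (x + u0) *\<^sub>R central_proj x' w"
  proof -
    have "B *v central_proj x u0 = central_proj x' w"
      by (simp add: B_def g(2) flip: matrix_vector_mul_assoc)
    moreover have "x + u0 = norm (x + u0) *\<^sub>R central_proj x u0"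
      using hyperplane_shift_nonzero[OF x u0x] by (simp add: central_proj_def)
    ultimately show ?thesis
      by (metis matrix_vector_mult_scaleR)
  qed
  have "u0 \<in> P"
    using central_proj_inner_pos[OF x' wx'] hyperplane_shift_nonzero[OF x u0x] by (simp add: P_def Bu0)
  moreover have "\<phi> u0 = w"
    unfolding \<phi>_def Bu0 using hyperplane_shift_nonzero[OF x u0x]
    by (simp add: gnomonic_scaleR gnomonic_central_proj x' wx')
  ultimately have u0T: "u0 \<in> T"
    using u0U w(1) T1 T2 by (simp add: T_def)
  have \<phi>: "\<phi> u \<in> U' \<and> F (orbit H (central_proj x u)) = orbit G (central_proj x' (\<phi> u))"
    if u: "u \<in> T" "u \<in> hyperplane x" for u
  proof
    have pos: "0 < (B *v (x + u)) \<bullet> x'"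
      using u by (simp add: T_def P_def)
    then show "\<phi> u \<in> U'"
      using u gnomonic_in_hyperplane[OF x', of "B *v (x + u)"] by (simp add: T_def T2 \<phi>_def)
    have "F (orbit H (central_proj x u)) = orbit G (Q *v central_proj x u)"
      using F norm_central_proj[OF x u(2)] by simp
    also have "\<dots> = orbit G (B *v central_proj x u)"
      by (simp add: B_def orbit_move[OF g(1)] flip: matrix_vector_mul_assoc)
    also have "B *v central_proj x u = central_proj x' (\<phi> u)"
      unfolding \<phi>_def central_proj_gnomonic[OF pos] by (simp add: central_proj_eq_sgn sgn_orthogonal_matrix B)
    finally show "F (orbit H (central_proj x u)) = orbit G (central_proj x' (\<phi> u))" .
  qed
  show ?thesis
  proof (rule that[OF T u0T g(1)])
    fix u assume uT: "u \<in> T"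
    then show "0 < ((g ** Q) *v (x + u)) \<bullet> x'"
      by (simp add: T_def P_def B_def)
    assume u: "u \<in> hyperplane x"
    show "u \<in> coord_dom (sphere_chart H x U) (sphere_chart G x' U') F"
      using \<phi>[OF uT u] uT u by (auto simp: coord_dom_def T_def T1)
    show "coord_map (sphere_chart H x U) (sphere_chart G x' U') F u = gnomonic x' ((g ** Q) *v (x + u))"
      using \<phi>[OF uT u] inv_into_f_f[OF inj, of "\<phi> u"] by (simp add: coord_map_def \<phi>_def B_def)
  qed
qed

end

lemma has_derivative_matrix_vector_mult [derivative_intros]:
  assumes "(f has_derivative f') (at x within S)"
  shows "((\<lambda>x. (B :: real ^ 'n ^ 'm) *v f x) has_derivative (\<lambda>h. B *v f' h)) (at x within S)"
  by (rule bounded_linear.has_derivative[OF matrix_vector_mul_bounded_linear assms])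

lemma open_hproj_vimage: "open T \<Longrightarrow> open (hproj x -` T)"
  using continuous_open_vimage continuous_hproj[of UNIV x] by (simp add: open_vimage)

context free_rotation_group
begin

lemma openin_coord_dom:
  assumes "orthogonal_matrix Q" and F: "\<And>y. norm y = 1 \<Longrightarrow> F (orbit H y) = orbit G (Q *v y)"
    and U: "chart_domain H x U" and "chart_domain G x' U'"
  shows "openin (top_of_set (hyperplane x)) (coord_dom (sphere_chart H x U) (sphere_chart G x' U') F)"
    (is "openin ?X ?D")
proof (subst openin_subopen, intro ballI)
  fix u0 assume u0: "u0 \<in> ?D"
  then obtain T where "open T" "u0 \<in> T" "\<And>u. u \<in> T \<Longrightarrow> u \<in> hyperplane x \<Longrightarrow> u \<in> ?D"
    using coord_map_locally_gnomonic[OF assms u0] by metis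
  moreover have "u0 \<in> hyperplane x"
    using u0 chart_domain_subset[OF U] by (simp add: coord_dom_def)
  ultimately show "\<exists>T. openin ?X T \<and> u0 \<in> T \<and> T \<subseteq> ?D"
    by (intro exI[of _ "hyperplane x \<inter> T"]) (auto intro: openin_open_Int)
qed

lemma hsmooth_on_coord_map:
  assumes "orthogonal_matrix Q" and F: "\<And>y. norm y = 1 \<Longrightarrow> F (orbit H y) = orbit G (Q *v y)"
    and U: "chart_domain H x U" and U': "chart_domain G x' U'"
  shows "hsmooth_on x (coord_dom (sphere_chart H x U) (sphere_chart G x' U') F)
    (coord_map (sphere_chart H x U) (sphere_chart G x' U') F)"
    (is "hsmooth_on x ?D ?f")
  unfolding hsmooth_on_def
proof (rule smooth_on_if_locally_rational)
  fix z0 assume "z0 \<in> {z. hproj x z \<in> ?D}"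
  then have u0: "hproj x z0 \<in> ?D"
    by simp
  have x: "norm x = 1"
    using U by (simp add: chart_domain_def)
  obtain T g where T: "open T" "hproj x z0 \<in> T"
    and pos: "\<And>u. u \<in> T \<Longrightarrow> 0 < ((g ** Q) *v (x + u)) \<bullet> x'"
    and eq: "\<And>u. u \<in> T \<Longrightarrow> u \<in> hyperplane x \<Longrightarrow> ?f u = gnomonic x' ((g ** Q) *v (x + u))"
    using coord_map_locally_gnomonic[OF assms u0] by metis
  define B where "B = g ** Q"
  define N where "N z = B *v (x + hproj x z)" for z
  let ?T = "hproj x -` T"
  have Nb: "(\<lambda>z. N z \<bullet> b) \<in> rational_functions ?T" for b
  proof -
    define a where "a = transpose B *v b"
    have "N z \<bullet> b = x \<bullet> a + z \<bullet> (a - (x \<bullet> a) *\<^sub>R x)" for z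
      by (simp add: N_def matrix_vector_inner_transpose a_def[symmetric] hproj_def inner_add_left
          inner_diff_left inner_diff_right)
    then show ?thesis
      by (auto intro: rational_functions.intros)
  qed
  have pos': "0 < N z \<bullet> x'" if "z \<in> ?T" for z
    using pos that by (simp add: N_def B_def)
  have "(\<lambda>z. gnomonic x' (N z) \<bullet> b) \<in> rational_functions ?T" for b
  proof -
    have "(\<lambda>z. inverse (N z \<bullet> x') * (N z \<bullet> b) + - (x' \<bullet> b)) \<in> rational_functions ?T"
      using pos' by (intro rational_functions.add rational_functions.mult rational_functions.inverse
          rational_functions.const Nb) force
    then show ?thesis
      by (simp add: gnomonic_def inner_diff_left)
  qed
  moreover have "(?f \<circ> hproj x) z = gnomonic x' (N z)" if "z \<in> ?T" for z
    using that eq hproj_in_hyperplane[OF x] by (simp add: N_def B_def)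
  ultimately show "\<exists>T h. open T \<and> z0 \<in> T \<and> (\<forall>b\<in>Basis. (\<lambda>y. h y \<bullet> b) \<in> rational_functions T)
      \<and> (\<forall>y\<in>T. (?f \<circ> hproj x) y = h y)"
    using T by (intro exI[of _ ?T] exI[of _ "\<lambda>z. gnomonic x' (N z)"]) (auto intro: open_hproj_vimage)
qed

lemma smooth_map_induced:
  assumes Q: "orthogonal_matrix Q" and F: "\<And>y. norm y = 1 \<Longrightarrow> F (orbit H y) = orbit G (Q *v y)"
  shows "smooth_map (sphere_quotient H) (sphere_quotient G) F"
proof -
  have "F ` points (sphere_quotient H) \<subseteq> points (sphere_quotient G)"
    using F by (auto simp: points_sphere_quotient orthogonal_matrix_norm[OF Q])
  then show ?thesis
    unfolding smooth_map_def charts_sphere_quotient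
    using openin_coord_dom[OF assms] hsmooth_on_coord_map[OF assms] by auto
qed

lemma coord_map_has_derivative:
  assumes Q: "orthogonal_matrix Q" and F: "\<And>y. norm y = 1 \<Longrightarrow> F (orbit H y) = orbit G (Q *v y)"
    and U: "chart_domain H x U" and U': "chart_domain G x' U'"
    and u: "u \<in> coord_dom (sphere_chart H x U) (sphere_chart G x' U') F"
  shows "\<exists>T B. open T \<and> u \<in> T \<and> orthogonal_matrix B \<and> det B = det Q \<and>
    (\<forall>z\<in>T. 0 < (B *v (x + hproj x z)) \<bullet> x' \<and>
      (coord_map (sphere_chart H x U) (sphere_chart G x' U') F \<circ> hproj x) z = gnomonic x' (B *v (x + hproj x z))) \<and>
    ((coord_map (sphere_chart H x U) (sphere_chart G x' U') F \<circ> hproj x) has_derivative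
       (\<lambda>v. gnomonic_deriv x' (B *v (x + u)) (B *v hproj x v))) (at u)"
proof -
  let ?f = "coord_map (sphere_chart H x U) (sphere_chart G x' U') F"
  obtain T g where T: "open T" "u \<in> T" and g: "g \<in> G"
    and pos: "\<And>u. u \<in> T \<Longrightarrow> 0 < ((g ** Q) *v (x + u)) \<bullet> x'"
    and eq: "\<And>u. u \<in> T \<Longrightarrow> u \<in> hyperplane x \<Longrightarrow> ?f u = gnomonic x' ((g ** Q) *v (x + u))"
    using coord_map_locally_gnomonic[OF assms] by metis
  have x: "norm x = 1"
    using U by (simp add: chart_domain_def)
  define B where "B = g ** Q"
  have ux: "hproj x u = u"
    using u chart_domain_subset[OF U] by (simp add: coord_dom_def hproj_ident)
  have T': "open (hproj x -` T)" "u \<in> hproj x -` T"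
    using T by (auto intro: open_hproj_vimage simp: ux)
  have eq': "(?f \<circ> hproj x) z = gnomonic x' (B *v (x + hproj x z))" if "z \<in> hproj x -` T" for z
    using that eq hproj_in_hyperplane[OF x] by (simp add: B_def)
  have "((\<lambda>z. B *v (x + hproj x z)) has_derivative (\<lambda>v. B *v hproj x v)) (at u)"
    by (auto intro!: derivative_eq_intros hproj_has_derivative)
  then have "((\<lambda>z. gnomonic x' (B *v (x + hproj x z))) has_derivative
       (\<lambda>v. gnomonic_deriv x' (B *v (x + hproj x u)) (B *v hproj x v))) (at u)"
    using pos[OF T(2)] by (intro has_derivative_compose[OF _ gnomonic_has_derivative]) (auto simp: ux B_def)
  then have "((?f \<circ> hproj x) has_derivative
       (\<lambda>v. gnomonic_deriv x' (B *v (x + u)) (B *v hproj x v))) (at u)"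
    unfolding ux using T' eq'[symmetric] by (rule has_derivative_transform_within_open)
  moreover have "orthogonal_matrix B" "det B = det Q"
    using g Q by (auto simp: B_def orthogonal_matrix_mul orth det_mul det)
  moreover have "\<forall>z\<in>hproj x -` T. 0 < (B *v (x + hproj x z)) \<bullet> x'"
    using pos by (simp add: B_def)
  ultimately show ?thesis
    using T' eq' by (intro exI[of _ "hproj x -` T"] exI[of _ B]) simp
qed

lemma orientation_sign_induced:
  assumes Q: "orthogonal_matrix Q" and F: "\<And>y. norm y = 1 \<Longrightarrow> F (orbit H y) = orbit G (Q *v y)"
    and U: "chart_domain H x U" and U': "chart_domain G x' U'"
    and u: "u \<in> coord_dom (sphere_chart H x U) (sphere_chart G x' U') F"
  shows "orientation_sign x x' (hderiv x (coord_map (sphere_chart H x U) (sphere_chart G x' U') F) u) = det Q"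
proof -
  obtain T B where T: "open T" "u \<in> T" and B: "orthogonal_matrix B" "det B = det Q"
    and pos: "\<And>z. z \<in> T \<Longrightarrow> 0 < (B *v (x + hproj x z)) \<bullet> x'"
    and eq: "\<And>z. z \<in> T \<Longrightarrow> (coord_map (sphere_chart H x U) (sphere_chart G x' U') F \<circ> hproj x) z
       = gnomonic x' (B *v (x + hproj x z))"
    and D: "((coord_map (sphere_chart H x U) (sphere_chart G x' U') F \<circ> hproj x) has_derivative
       (\<lambda>v. gnomonic_deriv x' (B *v (x + u)) (B *v hproj x v))) (at u)"
    using coord_map_has_derivative[OF assms(1-5)] by blast
  have ux: "u \<in> hyperplane x"
    using u chart_domain_subset[OF U] by (simp add: coord_dom_def)
  then have "0 < (B *v (x + u)) \<bullet> x'"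
    using pos[OF T(2)] by (simp add: hproj_ident)
  then show ?thesis
    unfolding hderiv_def frechet_derivative_at[OF D, symmetric]
    using orientation_sign_gnomonic[OF B(1) _ _ ux] U U' B(2) by (simp add: chart_domain_def)
qed

text \<open>
Central projection intertwines the coordinate map with the orthogonal matrix \<open>B\<close> that represents the map
on the sphere. Differentiating this relation at \<open>u\<close> shows that the two pairs of tangent vectors differ by
\<open>B\<close>, which preserves inner products.
\<close>

lemma metric_induced:
  assumes Q: "orthogonal_matrix Q" and F: "\<And>y. norm y = 1 \<Longrightarrow> F (orbit H y) = orbit G (Q *v y)"
    and U: "chart_domain H x U" and U': "chart_domain G x' U'"
    and u: "u \<in> coord_dom (sphere_chart H x U) (sphere_chart G x' U') F"
  defines "f \<equiv> coord_map (sphere_chart H x U) (sphere_chart G x' U') F"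
  shows "hderiv x' (central_proj x') (f u) (hderiv x f u v) \<bullet> hderiv x' (central_proj x') (f u) (hderiv x f u w)
    = hderiv x (central_proj x) u v \<bullet> hderiv x (central_proj x) u w"
proof -
  have x: "norm x = 1" and x': "norm x' = 1"
    using U U' by (auto simp: chart_domain_def)
  have ux: "hproj x u = u"
    using u chart_domain_subset[OF U] by (simp add: coord_dom_def hproj_ident)
  obtain T B where T: "open T" "u \<in> T" and B: "orthogonal_matrix B" "det B = det Q"
    and pos: "\<And>z. z \<in> T \<Longrightarrow> 0 < (B *v (x + hproj x z)) \<bullet> x'"
    and eq: "\<And>z. z \<in> T \<Longrightarrow> (coord_map (sphere_chart H x U) (sphere_chart G x' U') F \<circ> hproj x) z
       = gnomonic x' (B *v (x + hproj x z))"
    and D: "((coord_map (sphere_chart H x U) (sphere_chart G x' U') F \<circ> hproj x) has_derivative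
       (\<lambda>v. gnomonic_deriv x' (B *v (x + u)) (B *v hproj x v))) (at u)"
    using coord_map_has_derivative[OF assms(1-5)] by blast
  define Df where "Df v = gnomonic_deriv x' (B *v (x + u)) (B *v hproj x v)" for v
  note eq = eq[folded f_def]
  have Df: "((f \<circ> hproj x) has_derivative Df) (at u)"
    using D by (simp add: f_def Df_def[abs_def])
  define D0 where "D0 = frechet_derivative (central_proj x \<circ> hproj x) (at u)"
  define D1 where "D1 = frechet_derivative (central_proj x' \<circ> hproj x') (at (f u))"
  have D0: "((central_proj x \<circ> hproj x) has_derivative D0) (at u)"
    unfolding D0_def using central_proj_hproj_differentiable[OF x] frechet_derivative_works by blast
  have D1: "((central_proj x' \<circ> hproj x') has_derivative D1) (at ((f \<circ> hproj x) u))"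
    unfolding D1_def o_apply[of f] ux
    using central_proj_hproj_differentiable[OF x'] frechet_derivative_works by blast
  have dB: "((\<lambda>z. B *v (central_proj x \<circ> hproj x) z) has_derivative (\<lambda>h. B *v D0 h)) (at u)"
    by (intro derivative_intros D0)
  have dD: "((\<lambda>z. (central_proj x' \<circ> hproj x') ((f \<circ> hproj x) z)) has_derivative (\<lambda>h. D1 (Df h))) (at u)"
    by (rule has_derivative_compose[OF Df D1])
  have eqz: "(central_proj x' \<circ> hproj x') ((f \<circ> hproj x) z) = B *v (central_proj x \<circ> hproj x) z" if "z \<in> T" for z
  proof -
    have "gnomonic x' (B *v (x + hproj x z)) \<in> hyperplane x'"
      using pos[OF that] by (intro gnomonic_in_hyperplane x') simp
    moreover have "f (hproj x z) = gnomonic x' (B *v (x + hproj x z))"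
      using eq[OF that] by simp
    moreover have "central_proj x' (gnomonic x' (B *v (x + hproj x z))) = B *v central_proj x (hproj x z)"
      by (simp add: central_proj_gnomonic pos[OF that] sgn_orthogonal_matrix[OF B(1)] central_proj_eq_sgn[of x])
    ultimately show ?thesis
      by (simp add: hproj_ident)
  qed
  have "(\<lambda>h. D1 (Df h)) = (\<lambda>h. B *v D0 h)"
    by (rule has_derivative_unique[OF has_derivative_transform_within_open[OF dD T eqz] dB])
  then have "D1 (Df h) = B *v D0 h" for h
    by meson
  moreover have "hderiv x f u = Df" "hderiv x' (central_proj x') (f u) = D1" "hderiv x (central_proj x) u = D0"
    using frechet_derivative_at[OF Df] by (simp_all add: hderiv_def D0_def D1_def)
  ultimately show ?thesis
    by (simp add: orthogonal_matrix_inner[OF B(1)])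
qed

end

lemma riemannian_isometry_induced:
  assumes G: "free_rotation_group G" and H: "free_rotation_group H" and Q: "orthogonal_matrix Q"
    and conj: "(\<lambda>A. Q ** A ** transpose Q) ` H = G"
  shows "riemannian_isometry (sphere_quotient H) (sphere_quotient G) ((`) ((*v) Q))"
    and "\<And>y. (*v) Q ` orbit H y = orbit G (Q *v y)"
proof -
  let ?F = "(`) ((*v) Q)"
  have Qt: "orthogonal_matrix (transpose Q)"
    using Q by simp
  show F: "?F (orbit H y) = orbit G (Q *v y)" for y
  proof -
    have "Q *v (A *v y) = (Q ** A ** transpose Q) *v (Q *v y)" for A
      by (simp add: orthogonal_matrix_cancel[OF Q] flip: matrix_vector_mul_assoc)
    then have "?F (orbit H y) = (\<lambda>B. B *v (Q *v y)) ` (\<lambda>A. Q ** A ** transpose Q) ` H"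
      unfolding orbit_def image_image by (rule image_cong[OF refl])
    then show ?thesis
      by (simp add: conj orbit_def)
  qed
  have injQ: "inj ((*v) Q)"
    by (metis Q injI orthogonal_matrix_cancel(4))
  have inj: "inj_on ?F A" for A
    using injQ by (meson inj_image_eq_iff inj_onI)
  have "?F ` orbit H ` sphere 0 1 = orbit G ` sphere 0 1"
  proof -
    have "?F ` orbit H ` sphere 0 1 = orbit G ` (*v) Q ` sphere 0 1"
      by (simp add: image_image F)
    also have "(*v) Q ` sphere 0 1 = sphere 0 1"
    proof -
      have "y \<in> (*v) Q ` sphere 0 1" if "norm y = 1" for y
        using that orthogonal_matrix_norm[OF Qt, of y]
        by (intro image_eqI[of _ _ "transpose Q *v y"]) (auto simp: orthogonal_matrix_cancel[OF Q])
      then show ?thesis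
        by (auto simp: orthogonal_matrix_norm[OF Q])
    qed
    finally show ?thesis .
  qed
  then have bij: "bij_betw ?F (points (sphere_quotient H)) (points (sphere_quotient G))"
    using inj by (simp add: bij_betw_def points_sphere_quotient)
  have invF: "inv_into (points (sphere_quotient H)) ?F (orbit G y) = orbit H (transpose Q *v y)" if "norm y = 1" for y
  proof (rule inv_into_f_eq[OF inj])
    show "orbit H (transpose Q *v y) \<in> points (sphere_quotient H)"
      using that by (auto simp: points_sphere_quotient orthogonal_matrix_norm[OF Qt])
    show "?F (orbit H (transpose Q *v y)) = orbit G y"
      by (simp add: F orthogonal_matrix_cancel[OF Q])
  qed
  have "smooth_map (sphere_quotient H) (sphere_quotient G) ?F"
    by (rule free_rotation_group.smooth_map_induced[OF G Q F])
  moreover have "smooth_map (sphere_quotient G) (sphere_quotient H) (inv_into (points (sphere_quotient H)) ?F)"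
    by (rule free_rotation_group.smooth_map_induced[OF H Qt invF])
  ultimately show "riemannian_isometry (sphere_quotient H) (sphere_quotient G) ?F"
    using bij free_rotation_group.metric_induced[OF G Q F]
    unfolding riemannian_isometry_def diffeomorphism_def charts_sphere_quotient Let_def by auto
qed

context free_rotation_group
begin

text \<open>
Each nontrivial group element moves \<open>x\<close>, and there are finitely many of them, so they all move \<open>x\<close> by at
least some \<open>m > 0\<close>.
\<close>

lemma orbit_locally_injective:
  assumes "norm x = 1"
  obtains \<delta> where "\<delta> > 0"
    "\<And>y z. dist y x < \<delta> \<Longrightarrow> dist z x < \<delta> \<Longrightarrow> orbit G y = orbit G z \<Longrightarrow> y = z"
proof -
  define m where "m = Min (insert 1 ((\<lambda>g. norm (g *v x - x)) ` (G - {mat 1})))"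
  have fin: "finite ((\<lambda>g. norm (g *v x - x)) ` (G - {mat 1}))"
    using local.finite by blast
  have "x \<noteq> 0"
    using assms by auto
  then have "m > 0"
    unfolding m_def using fin free by (subst Min_gr_iff) auto
  have m: "m \<le> norm (g *v x - x)" if "g \<in> G" "g \<noteq> mat 1" for g
    unfolding m_def using fin that by (intro Min_le) auto
  show ?thesis
  proof (rule that[of "m / 2"])
    show "m / 2 > 0"
      using \<open>m > 0\<close> by simp
    fix y z assume d: "dist y x < m / 2" "dist z x < m / 2" and "orbit G y = orbit G z"
    then obtain g where g: "g \<in> G" "z = g *v y"
      using orbit_eqD by blast
    have "g = mat 1"
    proof (rule ccontr)
      assume "g \<noteq> mat 1"
      then have "m \<le> norm (g *v x - x)"
        using m g by blast
      also have "g *v x - x = g *v (x - y) + (z - x)"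
        by (simp add: g matrix_vector_mult_diff_distrib)
      also have "norm \<dots> \<le> norm (x - y) + norm (z - x)"
        using norm_triangle_ineq[of "g *v (x - y)" "z - x"] by (simp add: orthogonal_matrix_norm orth g)
      also have "\<dots> < m"
        using d by (simp add: dist_norm norm_minus_commute)
      finally show False
        by simp
    qed
    then show "y = z"
      using g by simp
  qed
qed

lemma chart_domain_exists:
  assumes x: "norm x = 1"
  obtains U where "chart_domain G x U" "0 \<in> U"
proof -
  obtain \<delta> where \<delta>: "\<delta> > 0" "\<And>y z. dist y x < \<delta> \<Longrightarrow> dist z x < \<delta> \<Longrightarrow> orbit G y = orbit G z \<Longrightarrow> y = z"
    using orbit_locally_injective[OF x] by blast
  let ?c = "central_proj x \<circ> hproj x"
  define U where "U = hyperplane x \<inter> (?c -` ball x \<delta>)"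
  have "continuous_on UNIV ?c"
    by (intro continuous_at_imp_continuous_on ballI differentiable_imp_continuous_within
        central_proj_hproj_differentiable x)
  then have "open (?c -` ball x \<delta>)"
    by (intro open_vimage) auto
  then have "openin (top_of_set (hyperplane x)) U"
    unfolding U_def by (rule openin_open_Int)
  moreover have "inj_on (orbit G \<circ> central_proj x) U"
  proof (rule inj_onI)
    fix u v assume uv: "u \<in> U" "v \<in> U" "(orbit G \<circ> central_proj x) u = (orbit G \<circ> central_proj x) v"
    then have "central_proj x u = central_proj x v"
      by (intro \<delta>(2)) (auto simp: U_def hproj_ident dist_commute)
    then show "u = v"
      using uv gnomonic_central_proj[OF x] by (metis IntD1 U_def)
  qed
  moreover have "0 \<in> hyperplane x"
    by (simp add: hyperplane_def)
  then have "0 \<in> U"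
    using \<delta>(1) by (simp add: U_def hproj_ident central_proj_0 x)
  ultimately show ?thesis
    using that x by (simp add: chart_domain_def)
qed

text \<open>
Otherwise the open set \<open>W\<close> would be covered by the finitely many proper subspaces \<open>K g\<close> on which \<open>P\<close> and
\<open>g ** Q\<close> agree, but these have measure zero.
\<close>

lemma orbit_eq_on_open_imp:
  assumes W: "open W" "W \<noteq> {}" and eq: "\<And>y. y \<in> W \<Longrightarrow> orbit G (P *v y) = orbit G (Q *v y)"
  shows "\<exists>g\<in>G. P = g ** Q"
proof (rule ccontr)
  assume no: "\<not> (\<exists>g\<in>G. P = g ** Q)"
  define K where "K g = {y. P *v y = g *v (Q *v y)}" for g
  have "negligible (K g)" if "g \<in> G" for g
  proof (rule negligible_lowdim)
    have sub: "subspace (K g)"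
      by (rule subspaceI) (simp_all add: K_def algebra_simps)
    have "K g \<noteq> UNIV"
    proof
      assume "K g = UNIV"
      then have "P = g ** Q"
        by (simp add: K_def matrix_eq set_eq_iff flip: matrix_vector_mul_assoc)
      then show False
        using no that by blast
    qed
    moreover have "span (K g) = K g"
      using sub by (rule span_eq_iff[THEN iffD2])
    ultimately have "dim (K g) \<noteq> DIM(real ^ 'a)"
      using dim_eq_full[of "K g"] by metis
    then show "dim (K g) < DIM(real ^ 'a)"
      using dim_subset_UNIV[of "K g"] by linarith
  qed
  then have "negligible (\<Union>g\<in>G. K g)"
    using local.finite by (intro negligible_Union) auto
  moreover have "W \<subseteq> (\<Union>g\<in>G. K g)"
  proof
    fix y assume "y \<in> W"
    then obtain g where "g \<in> G" "P *v y = g *v (Q *v y)"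
      using orbit_eqD[OF eq[symmetric]] by blast
    then show "y \<in> (\<Union>g\<in>G. K g)"
      by (auto simp: K_def)
  qed
  ultimately show False
    using W open_not_negligible negligible_subset by blast
qed

end

section \<open>Local linearity of isometries\<close>

text \<open>
An open set contains a basis. The linear map \<open>g\<close> that agrees with \<open>\<Phi>\<close> on it has the same inner products
with all values of \<open>\<Phi>\<close> as \<open>\<Phi>\<close> itself, and therefore equals \<open>\<Phi>\<close> on \<open>W\<close>.
\<close>

lemma inner_preserving_on_open_imp_orthogonal:
  fixes \<Phi> :: "real ^ 'n \<Rightarrow> real ^ 'n"
  assumes W: "open W" "W \<noteq> {}" and inner: "\<And>y z. y \<in> W \<Longrightarrow> z \<in> W \<Longrightarrow> \<Phi> y \<bullet> \<Phi> z = y \<bullet> z"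
  shows "\<exists>Q. orthogonal_matrix Q \<and> (\<forall>y\<in>W. \<Phi> y = Q *v y)"
proof -
  have "span W = UNIV"
  proof -
    have "\<not> dim W < DIM(real ^ 'n)"
      using W empty_interior_lowdim[of W] by (metis interior_open)
    then have "dim W = DIM(real ^ 'n)"
      using dim_subset_UNIV[of W] by linarith
    then show ?thesis
      using dim_eq_full[of W] by blast
  qed
  obtain B where B: "B \<subseteq> W" "independent B" "W \<subseteq> span B"
    using maximal_independent_subset by blast
  then have spanB: "span B = UNIV"
    by (metis \<open>span W = UNIV\<close> span_minimal subspace_span top.extremum_uniqueI)
  obtain g where g: "linear g" "\<And>b. b \<in> B \<Longrightarrow> g b = \<Phi> b"
    using linear_independent_extend[OF B(2), of \<Phi>] by auto
  have 1: "g a \<bullet> \<Phi> z = a \<bullet> z" if "z \<in> W" for a z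
  proof -
    have "a \<in> span B"
      by (simp add: spanB)
    then show ?thesis
    proof (induction rule: span_induct_alt)
      case base
      then show ?case
        by (simp add: linear_0[OF g(1)])
    next
      case (step c x y)
      then show ?case
        using B(1) inner that by (auto simp: linear_add[OF g(1)] linear_scale[OF g(1)] inner_add_left g(2))
    qed
  qed
  have 2: "g a \<bullet> g c = a \<bullet> c" for a c
  proof -
    have "c \<in> span B"
      by (simp add: spanB)
    then show ?thesis
    proof (induction rule: span_induct_alt)
      case base
      then show ?case
        by (simp add: linear_0[OF g(1)])
    next
      case (step c x y)
      then show ?case
        using B(1) 1 by (auto simp: linear_add[OF g(1)] linear_scale[OF g(1)] inner_add_right g(2))
    qed
  qed
  have orthg: "orthogonal_transformation g"
    using 2 g(1) by (simp add: orthogonal_transformation_def)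
  have "\<Phi> z = g z" if "z \<in> W" for z
  proof -
    obtain a where a: "\<Phi> z - g z = g a"
      using orthogonal_transformation_surj[OF orthg] by (metis surjD)
    have "(\<Phi> z - g z) \<bullet> g a = 0"
      using 1[OF that, of a] 2[of a z] by (simp add: inner_diff_left inner_diff_right inner_commute)
    then show ?thesis
      by (simp flip: a)
  qed
  moreover have "orthogonal_matrix (matrix g)" "g z = matrix g *v z" for z
    using orthg g(1) by (simp_all add: orthogonal_transformation_matrix matrix_works)
  ultimately show ?thesis
    by metis
qed

lemma unit_vector_derivative_orthogonal:
  fixes c :: "'a::real_normed_vector \<Rightarrow> 'b::real_inner"
  assumes D: "(c has_derivative D) (at y)" and W: "open W" "y \<in> W" "\<And>z. z \<in> W \<Longrightarrow> norm (c z) = 1"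
  shows "c y \<bullet> D h = 0"
proof -
  have "((\<lambda>z. c z \<bullet> c z) has_derivative (\<lambda>h. c y \<bullet> D h + D h \<bullet> c y)) (at y)"
    by (intro has_derivative_inner D)
  moreover have "((\<lambda>z. c z \<bullet> c z) has_derivative (\<lambda>h. 0)) (at y)"
    by (rule has_derivative_transform_within_open[OF has_derivative_const[of 1] W(1,2)])
      (simp add: W dot_square_norm)
  ultimately have "(\<lambda>h. c y \<bullet> D h + D h \<bullet> c y) = (\<lambda>h. 0)"
    by (rule has_derivative_unique)
  then have "c y \<bullet> D h + D h \<bullet> c y = 0"
    by meson
  then show ?thesis
    by (simp add: inner_commute)
qed

text \<open>
As \<open>c\<close> has constant length, its derivative is orthogonal to \<open>c y\<close>, and the theorem of Pythagoras applies.
\<close>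

lemma unit_direction_decomposition_norm:
  fixes c :: "'a::euclidean_space \<Rightarrow> 'b::euclidean_space"
  assumes D: "(c has_derivative D) (at y)" and W: "open W" "y \<in> W" "\<And>z. z \<in> W \<Longrightarrow> norm (c z) = 1"
    and y: "y \<noteq> 0"
  defines "\<Phi>' \<equiv> \<lambda>h. norm y *\<^sub>R D h + (h \<bullet> sgn y) *\<^sub>R c y"
  shows "((\<lambda>z. norm z *\<^sub>R c z) has_derivative \<Phi>') (at y)"
    and "(norm (\<Phi>' h))\<^sup>2 = (norm y * norm (D h))\<^sup>2 + (h \<bullet> sgn y)\<^sup>2"
proof -
  show "((\<lambda>z. norm z *\<^sub>R c z) has_derivative \<Phi>') (at y)"
    unfolding \<Phi>'_def using has_derivative_scaleR[OF has_derivative_norm[OF y] D] by (simp add: inner_commute)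
  have "c y \<bullet> D h = 0"
    by (rule unit_vector_derivative_orthogonal[OF D W])
  then have "norm (\<Phi>' h) ^ 2 = norm (norm y *\<^sub>R D h) ^ 2 + norm ((h \<bullet> sgn y) *\<^sub>R c y) ^ 2"
    unfolding \<Phi>'_def by (intro norm_add_Pythagorean) (simp add: orthogonal_def inner_commute)
  then show "(norm (\<Phi>' h))\<^sup>2 = (norm y * norm (D h))\<^sup>2 + (h \<bullet> sgn y)\<^sup>2"
    using W by simp
qed

lemma zero_in_coord_dom:
  assumes "norm x = 1" "norm x' = 1" "0 \<in> U" "0 \<in> U'" "F (orbit H x) = orbit G x'"
  shows "0 \<in> coord_dom (sphere_chart H x U) (sphere_chart G x' U') F"
proof -
  have "orbit G x' = (orbit G \<circ> central_proj x') 0"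
    using assms by (simp add: central_proj_0)
  then have "orbit G x' \<in> (orbit G \<circ> central_proj x') ` U'"
    using assms(4) by (rule image_eqI)
  then show ?thesis
    using assms by (simp add: coord_dom_def central_proj_0)
qed

text \<open>
A lift of \<open>F\<close> to the spheres near \<open>x\<close>, extended radially to an open set of the ambient space. The radial
extension allows ordinary derivatives and makes an isometry of spheres an isometry of Euclidean domains.
\<close>

definition conical_lift ::
  "(real ^ 'k ^ 'k) set \<Rightarrow> (real ^ 'k ^ 'k) set \<Rightarrow> ((real ^ 'k) set \<Rightarrow> (real ^ 'k) set) \<Rightarrow>
    real ^ 'k \<Rightarrow> real ^ 'k \<Rightarrow> (real ^ 'k) set \<Rightarrow> (real ^ 'k \<Rightarrow> real ^ 'k) \<Rightarrow> bool" where
  "conical_lift H G F x x' W \<Phi> \<longleftrightarrow> open W \<and> x \<in> W \<and> 0 \<notin> W \<and> \<Phi> x = x' \<and>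
    (\<forall>y\<in>W. norm (\<Phi> y) = norm y) \<and>
    (\<forall>y\<in>W. F (orbit H (sgn y)) = orbit G (sgn (\<Phi> y))) \<and>
    (\<forall>y\<in>W. \<Phi> differentiable (at y))"

text \<open>
The lift is the coordinate map \<open>f\<close> between charts at \<open>x\<close> and \<open>x'\<close>, conjugated by central projections and
multiplied by the norm. Its derivative splits into a radial part and a part \<open>Dc' \<circ> Df\<close> tangent to the
sphere. For an isometry the latter has the same length as the corresponding part \<open>Dc\<close> of the identity,
regarded as the radial extension of \<open>sgn\<close>; so the lengths of the whole derivatives agree too.
\<close>

lemma local_conical_lift:
  fixes F :: "(real ^ 'k) set \<Rightarrow> (real ^ 'k) set"
  assumes H: "free_rotation_group H" and G: "free_rotation_group G"
    and smooth: "smooth_map (sphere_quotient H) (sphere_quotient G) F"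
    and x: "norm x = 1" and x': "norm x' = 1" and Fx: "F (orbit H x) = orbit G x'"
  shows "\<exists>W \<Phi>. conical_lift H G F x x' W \<Phi> \<and>
    (riemannian_isometry (sphere_quotient H) (sphere_quotient G) F \<longrightarrow>
      (\<forall>y\<in>W. \<forall>h. norm (frechet_derivative \<Phi> (at y) h) = norm h))"
proof -
  obtain U where U: "chart_domain H x U" "0 \<in> U"
    using free_rotation_group.chart_domain_exists[OF H x] by blast
  obtain U' where U': "chart_domain G x' U'" "0 \<in> U'"
    using free_rotation_group.chart_domain_exists[OF G x'] by blast
  let ?c = "sphere_chart H x U" and ?c' = "sphere_chart G x' U'"
  define Dm where "Dm = coord_dom ?c ?c' F"
  define f where "f = coord_map ?c ?c' F"
  have c: "?c \<in> charts (sphere_quotient H)" "?c' \<in> charts (sphere_quotient G)"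
    using U U' by (auto simp: charts_sphere_quotient)
  have "\<forall>c\<in>charts (sphere_quotient H). \<forall>c'\<in>charts (sphere_quotient G).
      openin (top_of_set (hyperplane (cnormal c))) (coord_dom c c' F) \<and>
      hsmooth_on (cnormal c) (coord_dom c c' F) (coord_map c c' F)"
    using smooth[unfolded smooth_map_def] by (rule conjunct2)
  from bspec[OF bspec[OF this c(1)] c(2)]
  have "openin (top_of_set (hyperplane x)) Dm" and hs: "hsmooth_on x Dm f"
    by (simp_all add: Dm_def f_def)
  then obtain T where T: "open T" "Dm = hyperplane x \<inter> T"
    by (auto simp: openin_open)
  have "Ck_on (Suc 0) {z. hproj x z \<in> Dm} (f \<circ> hproj x)"
    using hs unfolding hsmooth_on_def smooth_on_def by blast
  then have fdiff: "(f \<circ> hproj x) differentiable (at u)" if "u \<in> Dm" for u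
    using that T by (simp add: hproj_ident)
  have D0: "0 \<in> Dm"
    unfolding Dm_def using x x' U(2) U'(2) Fx by (rule zero_in_coord_dom)
  have fU': "f u \<in> U'" and fF: "orbit G (central_proj x' (f u)) = F (orbit H (central_proj x u))" if "u \<in> Dm" for u
  proof -
    have "F (orbit H (central_proj x u)) \<in> (orbit G \<circ> central_proj x') ` U'"
      using that by (simp add: Dm_def coord_dom_def)
    from inv_into_into[OF this] f_inv_into_f[OF this]
    show "f u \<in> U'" "orbit G (central_proj x' (f u)) = F (orbit H (central_proj x u))"
      by (simp_all add: f_def coord_map_def)
  qed
  have fx': "f u \<in> hyperplane x'" if "u \<in> Dm" for u
    using chart_domain_subset[OF U'(1) fU'[OF that]] .
  have inj': "inj_on (orbit G \<circ> central_proj x') U'"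
    using U' by (simp add: chart_domain_def)
  have f0: "f 0 = 0"
    using fF[OF D0] Fx by (intro inj_onD[OF inj' _ fU'[OF D0] U'(2)]) (simp add: central_proj_0 x x')
  define P where "P = {y. 0 < y \<bullet> x}"
  define W where "W = P \<inter> gnomonic x -` T"
  have "open P"
    unfolding P_def by (intro open_Collect_less continuous_intros)
  moreover have "continuous_on P (gnomonic x)"
    by (intro continuous_at_imp_continuous_on) (auto simp: P_def intro: isCont_gnomonic)
  ultimately have W: "open W"
    unfolding W_def using T(1) by (intro continuous_open_preimage)
  have pos: "0 < y \<bullet> x" if "y \<in> W" for y
    using that by (simp add: W_def P_def)
  have gx: "gnomonic x x = 0"
    by (simp add: gnomonic_def dot_square_norm x)
  have xW: "x \<in> W"
    using D0 T by (simp add: W_def P_def gx dot_square_norm x)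
  have gD: "gnomonic x y \<in> Dm" if "y \<in> W" for y
    using that gnomonic_in_hyperplane[OF x, of y] pos[OF that] by (simp add: W_def T(2))
  define c' where "c' = (\<lambda>y. (central_proj x' \<circ> hproj x') ((f \<circ> hproj x) (gnomonic x y)))"
  have c'_eq: "c' y = central_proj x' (f (gnomonic x y))" if "y \<in> W" for y
    using gD[OF that] T(2) fx'[OF gD[OF that]] by (simp add: c'_def hproj_ident)
  have norm_c': "norm (c' y) = 1" if "y \<in> W" for y
    using fx'[OF gD[OF that]] by (simp add: c'_eq[OF that] norm_central_proj x')
  define \<Phi> where "\<Phi> = (\<lambda>y. norm y *\<^sub>R c' y)"
  have y0: "y \<noteq> 0" if "y \<in> W" for y
    using pos[OF that] by auto
  define Df where "Df u = frechet_derivative (f \<circ> hproj x) (at u)" for u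
  define Dc where "Dc u = frechet_derivative (central_proj x \<circ> hproj x) (at u)" for u
  define Dc' where "Dc' u = frechet_derivative (central_proj x' \<circ> hproj x') (at (f u))" for u
  have Dc': "(c' has_derivative (\<lambda>h. Dc' (gnomonic x y) (Df (gnomonic x y) (gnomonic_deriv x y h)))) (at y)"
    if y: "y \<in> W" for y
  proof -
    have 1: "(gnomonic x has_derivative gnomonic_deriv x y) (at y)"
      using pos[OF y] by (intro gnomonic_has_derivative) simp
    have 2: "((f \<circ> hproj x) has_derivative Df (gnomonic x y)) (at (gnomonic x y))"
      unfolding Df_def using fdiff[OF gD[OF y]] frechet_derivative_works by blast
    have "(f \<circ> hproj x) (gnomonic x y) = f (gnomonic x y)"
      using gD[OF y] T(2) by (simp add: hproj_ident)
    then have 3: "((central_proj x' \<circ> hproj x') has_derivative Dc' (gnomonic x y)) (at ((f \<circ> hproj x) (gnomonic x y)))"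
      unfolding Dc'_def using central_proj_hproj_differentiable[OF x'] frechet_derivative_works by metis
    show ?thesis
      unfolding c'_def by (rule has_derivative_compose[OF has_derivative_compose[OF 1 2] 3])
  qed
  note \<Phi>' = unit_direction_decomposition_norm[OF Dc' W _ _ y0, folded \<Phi>_def]
  show ?thesis
    unfolding conical_lift_def
  proof (intro exI[of _ W] exI[of _ \<Phi>] conjI ballI impI allI)
    show "0 \<notin> W"
      using y0 by blast
    show "\<Phi> x = x'"
      by (simp add: \<Phi>_def c'_eq[OF xW] gx f0 central_proj_0 x x')
    fix y assume y: "y \<in> W"
    show "norm (\<Phi> y) = norm y"
      by (simp add: \<Phi>_def norm_c'[OF y])
    have "sgn (c' y) = c' y"
      by (simp add: sgn_div_norm norm_c'[OF y])
    then have "sgn (\<Phi> y) = c' y"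
      using y0[OF y] by (simp add: \<Phi>_def sgn_scaleR)
    then show "F (orbit H (sgn y)) = orbit G (sgn (\<Phi> y))"
      using fF[OF gD[OF y]] by (simp add: c'_eq[OF y] central_proj_gnomonic pos[OF y])
    show "\<Phi> differentiable (at y)"
      using \<Phi>'(1)[OF y y norm_c' y] differentiableI by blast
    fix h assume iso: "riemannian_isometry (sphere_quotient H) (sphere_quotient G) F"
    let ?u = "gnomonic x y" and ?k = "gnomonic_deriv x y h"
    have "?k \<in> hyperplane x"
      using pos[OF y] by (simp add: gnomonic_deriv_def hyperplane_def inner_diff_left power2_eq_square divide_inverse mult.commute)
    moreover have "?u \<in> coord_dom ?c ?c' F"
      using gD[OF y] by (simp add: Dm_def)
    moreover have "\<forall>c\<in>charts (sphere_quotient H). \<forall>c'\<in>charts (sphere_quotient G). \<forall>u\<in>coord_dom c c' F.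
        \<forall>v\<in>hyperplane (cnormal c). \<forall>w\<in>hyperplane (cnormal c).
        cgram c' (coord_map c c' F u) (hderiv (cnormal c) (coord_map c c' F) u v)
          (hderiv (cnormal c) (coord_map c c' F) u w) = cgram c u v w"
      using iso[unfolded riemannian_isometry_def Let_def] by (rule conjunct2)
    from bspec[OF bspec[OF this c(1)] c(2)]
    have "?u \<in> coord_dom ?c ?c' F \<Longrightarrow> ?k \<in> hyperplane x \<Longrightarrow>
        Dc' ?u (Df ?u ?k) \<bullet> Dc' ?u (Df ?u ?k) = Dc ?u ?k \<bullet> Dc ?u ?k"
      by (simp add: Dc'_def Df_def Dc_def hderiv_def f_def)
    ultimately have "Dc' ?u (Df ?u ?k) \<bullet> Dc' ?u (Df ?u ?k) = Dc ?u ?k \<bullet> Dc ?u ?k"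
      by blast
    then have eq: "norm (Dc' ?u (Df ?u ?k)) = norm (Dc ?u ?k)"
      by (simp add: norm_eq_sqrt_inner)
    have s: "((\<lambda>y. (central_proj x \<circ> hproj x) (gnomonic x y)) has_derivative (\<lambda>h. Dc ?u (gnomonic_deriv x y h))) (at y)"
    proof -
      have 1: "(gnomonic x has_derivative gnomonic_deriv x y) (at y)"
        using pos[OF y] by (intro gnomonic_has_derivative) simp
      have 2: "((central_proj x \<circ> hproj x) has_derivative Dc ?u) (at ?u)"
        unfolding Dc_def using central_proj_hproj_differentiable[OF x] frechet_derivative_works by blast
      show ?thesis
        by (rule has_derivative_compose[OF 1 2])
    qed
    have s_eq: "(central_proj x \<circ> hproj x) (gnomonic x z) = sgn z" if "z \<in> W" for z
      using pos[OF that] gnomonic_in_hyperplane[OF x, of z] by (simp add: hproj_ident central_proj_gnomonic)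
    note s' = unit_direction_decomposition_norm[OF s W y _ y0[OF y]]
    have ns: "norm ((central_proj x \<circ> hproj x) (gnomonic x z)) = 1" if "z \<in> W" for z
      unfolding s_eq[OF that] using y0[OF that] by (simp add: norm_sgn)
    have "((\<lambda>z. norm z *\<^sub>R (central_proj x \<circ> hproj x) (gnomonic x z)) has_derivative (\<lambda>h. h)) (at y)"
      by (rule has_derivative_transform_within_open[OF has_derivative_ident W y])
        (simp only: s_eq, simp add: sgn_div_norm y0)
    then have "(\<lambda>h. h) = (\<lambda>h. norm y *\<^sub>R Dc ?u (gnomonic_deriv x y h) + (h \<bullet> sgn y) *\<^sub>R (central_proj x \<circ> hproj x) ?u)"
      by (rule has_derivative_unique[OF _ s'(1)]) (rule ns)
    then have "h = norm y *\<^sub>R Dc ?u ?k + (h \<bullet> sgn y) *\<^sub>R (central_proj x \<circ> hproj x) ?u"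
      by meson
    moreover have "(norm (norm y *\<^sub>R Dc ?u ?k + (h \<bullet> sgn y) *\<^sub>R (central_proj x \<circ> hproj x) ?u))\<^sup>2
        = (norm y * norm (Dc ?u ?k))\<^sup>2 + (h \<bullet> sgn y)\<^sup>2"
      by (rule s'(2)) (rule ns)
    ultimately have "(norm h)\<^sup>2 = (norm y * norm (Dc ?u ?k))\<^sup>2 + (h \<bullet> sgn y)\<^sup>2"
      by metis
    then have "(norm (frechet_derivative \<Phi> (at y) h))\<^sup>2 = (norm h)\<^sup>2"
      using \<Phi>'(2)[OF y y norm_c' y, of h] frechet_derivative_at[OF \<Phi>'(1)[OF y y norm_c' y], symmetric] by (simp add: eq)
    then show "norm (frechet_derivative \<Phi> (at y) h) = norm h"
      by simp
  qed (rule W xW)+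
qed

text \<open>
Near \<open>x\<close>, the points \<open>y\<close> and \<open>\<Psi> (\<Phi> y)\<close> have directions in the same orbit, and both directions are close
to \<open>x\<close>, where the orbit map is injective.
\<close>

lemma conical_lifts_inverse:
  fixes x x' :: "real ^ 'k"
  assumes H: "free_rotation_group H" and x: "norm x = 1"
    and \<Phi>: "conical_lift H G F x x' W \<Phi>" and \<Psi>: "conical_lift G H F' x' x W' \<Psi>"
    and inv: "\<And>y. norm y = 1 \<Longrightarrow> F' (F (orbit H y)) = orbit H y"
  shows "eventually (\<lambda>y. y \<in> W \<and> \<Phi> y \<in> W' \<and> \<Psi> (\<Phi> y) = y) (nhds x)"
proof -
  obtain \<delta> where \<delta>: "\<delta> > 0" "\<And>y z. dist y x < \<delta> \<Longrightarrow> dist z x < \<delta> \<Longrightarrow> orbit H y = orbit H z \<Longrightarrow> y = z"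
    using free_rotation_group.orbit_locally_injective[OF H x] by blast
  note \<Phi> = \<Phi>[unfolded conical_lift_def]
  note \<Psi> = \<Psi>[unfolded conical_lift_def]
  have sx: "sgn x = x" "x \<noteq> 0"
    using x by (auto simp: sgn_div_norm)
  have "isCont \<Phi> x" "isCont \<Psi> x'"
    using \<Phi> \<Psi> differentiable_imp_continuous_within by blast+
  then have lim: "(\<Phi> \<longlongrightarrow> x') (nhds x)" "(\<Psi> \<longlongrightarrow> x) (nhds x')"
    using \<Phi> \<Psi> tendsto_at_iff_tendsto_nhds[of \<Phi> x] tendsto_at_iff_tendsto_nhds[of \<Psi> x']
    by (simp_all add: isCont_def)
  then have \<Psi>\<Phi>: "((\<lambda>y. \<Psi> (\<Phi> y)) \<longlongrightarrow> x) (nhds x)"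
    by (blast intro: filterlim_compose)
  have id: "((\<lambda>y. y) \<longlongrightarrow> x) (nhds x)"
    by (simp add: filterlim_def)
  have s1: "((\<lambda>y. sgn (\<Psi> (\<Phi> y))) \<longlongrightarrow> x) (nhds x)"
    using tendsto_sgn[OF \<Psi>\<Phi> sx(2)] by (simp add: sx)
  have s2: "((\<lambda>y. sgn y) \<longlongrightarrow> x) (nhds x)"
    using tendsto_sgn[OF id sx(2)] by (simp add: sx)
  have "eventually (\<lambda>y. y \<in> W) (nhds x)"
    using \<Phi> eventually_nhds_in_open by blast
  moreover have "eventually (\<lambda>y. \<Phi> y \<in> W') (nhds x)"
    using \<Psi> by (intro topological_tendstoD[OF lim(1)]) auto
  moreover have "eventually (\<lambda>y. dist (sgn (\<Psi> (\<Phi> y))) x < \<delta>) (nhds x)"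
    by (rule tendstoD[OF s1 \<delta>(1)])
  moreover have "eventually (\<lambda>y. dist (sgn y) x < \<delta>) (nhds x)"
    by (rule tendstoD[OF s2 \<delta>(1)])
  ultimately show ?thesis
  proof eventually_elim
    case (elim y)
    then have y0: "y \<noteq> 0"
      using \<Phi> by auto
    have "orbit H (sgn (\<Psi> (\<Phi> y))) = F' (F (orbit H (sgn y)))"
      using elim \<Phi> \<Psi> by simp
    also have "\<dots> = orbit H (sgn y)"
      using y0 by (intro inv) (simp add: norm_sgn)
    finally have sgn: "sgn (\<Psi> (\<Phi> y)) = sgn y"
      using elim \<delta>(2) by blast
    have norm: "norm (\<Psi> (\<Phi> y)) = norm y"
      using elim \<Phi> \<Psi> by simp
    have "\<Psi> (\<Phi> y) = norm (\<Psi> (\<Phi> y)) *\<^sub>R sgn (\<Psi> (\<Phi> y))"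
      using y0 norm by (simp add: sgn_div_norm)
    also have "\<dots> = y"
      unfolding sgn norm using y0 by (simp add: sgn_div_norm)
    finally show ?case
      using elim by blast
  qed
qed

lemma norm_nonincreasing_if_isometric_derivative:
  fixes \<Phi> :: "'a::euclidean_space \<Rightarrow> 'b::euclidean_space"
  assumes "convex S" and diff: "\<And>y. y \<in> S \<Longrightarrow> \<Phi> differentiable (at y)"
    and iso: "\<And>y h. y \<in> S \<Longrightarrow> norm (frechet_derivative \<Phi> (at y) h) = norm h"
    and yz: "y \<in> S" "z \<in> S"
  shows "norm (\<Phi> y - \<Phi> z) \<le> norm (y - z)"
proof -
  have "norm (\<Phi> y - \<Phi> z) \<le> 1 * norm (y - z)"
  proof (rule differentiable_bound[OF \<open>convex S\<close> _ _ yz])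
    fix u assume u: "u \<in> S"
    show "(\<Phi> has_derivative frechet_derivative \<Phi> (at u)) (at u within S)"
      using diff[OF u] frechet_derivative_works has_derivative_at_withinI by blast
    show "onorm (frechet_derivative \<Phi> (at u)) \<le> 1"
      by (rule onorm_le) (simp add: iso u)
  qed
  then show ?thesis
    by simp
qed

text \<open>
The lift \<open>\<Phi>\<close> of \<open>F\<close> has norm preserving derivatives, and then so has the lift \<open>\<Psi>\<close> of the inverse, as
\<open>\<Phi> \<circ> \<Psi>\<close> is the identity. By the mean value inequality neither increases distances, so \<open>\<Phi>\<close> preserves
them near \<open>x\<close>; as it also preserves norms, it preserves inner products.
\<close>

lemma riemannian_isometry_locally_linear:
  fixes F :: "(real ^ 'k) set \<Rightarrow> (real ^ 'k) set"
  assumes H: "free_rotation_group H" and G: "free_rotation_group G"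
    and iso: "riemannian_isometry (sphere_quotient H) (sphere_quotient G) F"
    and x: "norm x = 1"
  shows "\<exists>Q e. e > 0 \<and> orthogonal_matrix Q \<and> (\<forall>y\<in>ball x e. F (orbit H (sgn y)) = orbit G (Q *v sgn y))"
proof -
  let ?M = "sphere_quotient H" and ?N = "sphere_quotient G"
  define F' where "F' = inv_into (points ?M) F"
  have bij: "bij_betw F (points ?M) (points ?N)" and smooth: "smooth_map ?M ?N F" "smooth_map ?N ?M F'"
    using iso by (auto simp: riemannian_isometry_def diffeomorphism_def F'_def)
  have pt: "orbit H y \<in> points ?M" "orbit G y \<in> points ?N" if "norm y = 1" for y
    using that by (auto simp: points_sphere_quotient)
  have inv: "F' (F (orbit H y)) = orbit H y" "F (F' (orbit G y)) = orbit G y" if "norm y = 1" for y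
    using bij pt[OF that] by (auto simp: F'_def bij_betw_inv_into_left bij_betw_inv_into_right)
  have "F (orbit H x) \<in> points ?N"
    using bij pt(1)[OF x] bij_betwE by blast
  then obtain x' where x': "norm x' = 1" "F (orbit H x) = orbit G x'"
    by (auto simp: points_sphere_quotient)
  then have F'x': "F' (orbit G x') = orbit H x"
    using inv(1)[OF x] by simp
  obtain W \<Phi> where \<Phi>: "conical_lift H G F x x' W \<Phi>"
    and \<Phi>i: "\<And>y h. y \<in> W \<Longrightarrow> norm (frechet_derivative \<Phi> (at y) h) = norm h"
    using local_conical_lift[OF H G smooth(1) x x'] iso by blast
  obtain W' \<Psi> where \<Psi>: "conical_lift G H F' x' x W' \<Psi>"
    using local_conical_lift[OF G H smooth(2) x'(1) x F'x'] by blast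
  have \<Phi>n: "norm (\<Phi> y) = norm y" and \<Phi>F: "F (orbit H (sgn y)) = orbit G (sgn (\<Phi> y))"
    and \<Phi>d: "\<Phi> differentiable (at y)" if "y \<in> W" for y
    using that \<Phi> by (auto simp: conical_lift_def)
  have \<Psi>d: "\<Psi> differentiable (at z)" if "z \<in> W'" for z
    using that \<Psi> by (auto simp: conical_lift_def)
  have 1: "eventually (\<lambda>y. y \<in> W \<and> \<Phi> y \<in> W' \<and> \<Psi> (\<Phi> y) = y) (nhds x)"
    by (rule conical_lifts_inverse[OF H x \<Phi> \<Psi> inv(1)])
  have "eventually (\<lambda>z. z \<in> W' \<and> \<Psi> z \<in> W \<and> \<Phi> (\<Psi> z) = z) (nhds x')"
    by (rule conical_lifts_inverse[OF G x'(1) \<Psi> \<Phi> inv(2)])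
  then obtain r' where r': "r' > 0" "\<And>z. z \<in> ball x' r' \<Longrightarrow> z \<in> W' \<and> \<Psi> z \<in> W \<and> \<Phi> (\<Psi> z) = z"
    by (auto simp: eventually_nhds_metric dist_commute)
  have "x \<in> W" "\<Phi> x = x'"
    using \<Phi> by (auto simp: conical_lift_def)
  then have "(\<Phi> \<longlongrightarrow> x') (nhds x)"
    using differentiable_imp_continuous_within[OF \<Phi>d[of x]] tendsto_at_iff_tendsto_nhds[of \<Phi> x]
    by (simp add: continuous_at)
  from eventually_conj[OF 1 tendstoD[OF this r'(1)]]
  obtain r where r: "r > 0" "\<And>y. y \<in> ball x r \<Longrightarrow> y \<in> W \<and> \<Psi> (\<Phi> y) = y \<and> \<Phi> y \<in> ball x' r'"
    by (auto simp: eventually_nhds_metric dist_commute)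
  have \<Phi>1: "norm (\<Phi> y - \<Phi> z) \<le> norm (y - z)" if "y \<in> ball x r" "z \<in> ball x r" for y z
    by (rule norm_nonincreasing_if_isometric_derivative[OF convex_ball _ _ that]) (use r \<Phi>d \<Phi>i in auto)
  have \<Psi>i: "norm (frechet_derivative \<Psi> (at z) h) = norm h" if z: "z \<in> ball x' r'" for z h
  proof -
    have "(\<Psi> has_derivative frechet_derivative \<Psi> (at z)) (at z)"
      using r'(2)[OF z] \<Psi>d frechet_derivative_works by blast
    moreover have "(\<Phi> has_derivative frechet_derivative \<Phi> (at (\<Psi> z))) (at (\<Psi> z))"
      using r'(2)[OF z] \<Phi>d frechet_derivative_works by blast
    ultimately have "((\<lambda>z. \<Phi> (\<Psi> z)) has_derivative (\<lambda>h. frechet_derivative \<Phi> (at (\<Psi> z)) (frechet_derivative \<Psi> (at z) h))) (at z)"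
      by (rule has_derivative_compose)
    moreover have "((\<lambda>z. \<Phi> (\<Psi> z)) has_derivative (\<lambda>h. h)) (at z)"
      by (rule has_derivative_transform_within_open[OF has_derivative_ident open_ball z]) (simp add: r'(2))
    ultimately have "(\<lambda>h. frechet_derivative \<Phi> (at (\<Psi> z)) (frechet_derivative \<Psi> (at z) h)) = (\<lambda>h. h)"
      by (rule has_derivative_unique)
    then have "frechet_derivative \<Phi> (at (\<Psi> z)) (frechet_derivative \<Psi> (at z) h) = h"
      by meson
    then show ?thesis
      using \<Phi>i[of "\<Psi> z" "frechet_derivative \<Psi> (at z) h"] r'(2)[OF z] by simp
  qed
  have \<Psi>1: "norm (\<Psi> y - \<Psi> z) \<le> norm (y - z)" if "y \<in> ball x' r'" "z \<in> ball x' r'" for y z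
    by (rule norm_nonincreasing_if_isometric_derivative[OF convex_ball _ _ that]) (use r' \<Psi>d \<Psi>i in auto)
  have "norm (\<Phi> y - \<Phi> z) = norm (y - z)" if "y \<in> ball x r" "z \<in> ball x r" for y z
    using \<Phi>1[OF that] \<Psi>1[of "\<Phi> y" "\<Phi> z"] r(2)[OF that(1)] r(2)[OF that(2)] by simp
  then have "\<Phi> y \<bullet> \<Phi> z = y \<bullet> z" if "y \<in> ball x r" "z \<in> ball x r" for y z
    using that r(2) \<Phi>n by (simp add: dot_norm_neg)
  then obtain Q where Q: "orthogonal_matrix Q" "\<And>y. y \<in> ball x r \<Longrightarrow> \<Phi> y = Q *v y"
    using inner_preserving_on_open_imp_orthogonal[of "ball x r" \<Phi>] r(1) by auto
  have "F (orbit H (sgn y)) = orbit G (Q *v sgn y)" if "y \<in> ball x r" for y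
    using \<Phi>F[of y] r(2)[OF that] by (simp add: Q(2)[OF that] sgn_orthogonal_matrix Q(1))
  then show ?thesis
    using r(1) Q(1) by blast
qed

section \<open>Isometries of sphere quotients\<close>

text \<open>
Two local representatives of \<open>F\<close> that are valid on a common open set differ by an element of \<open>G\<close>. Hence
the relation \<open>R\<close> of being represented by the same coset is locally trivial on the sphere, which is connected by
the dimension bound.
\<close>

lemma riemannian_isometry_linear:
  fixes F :: "(real ^ 'k) set \<Rightarrow> (real ^ 'k) set"
  assumes dim: "2 \<le> CARD('k)" and H: "free_rotation_group H" and G: "free_rotation_group G"
    and iso: "riemannian_isometry (sphere_quotient H) (sphere_quotient G) F"
  obtains Q where "orthogonal_matrix Q" "\<And>y. norm y = 1 \<Longrightarrow> F (orbit H y) = orbit G (Q *v y)"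
proof -
  have "\<forall>x\<in>sphere 0 1. \<exists>Q e. e > 0 \<and> orthogonal_matrix Q \<and> (\<forall>y\<in>ball x e. F (orbit H (sgn y)) = orbit G (Q *v sgn y))"
    using riemannian_isometry_locally_linear[OF H G iso] by simp
  then obtain Q e where Qe: "\<And>x. x \<in> sphere 0 1 \<Longrightarrow> e x > 0 \<and> orthogonal_matrix (Q x) \<and>
      (\<forall>y\<in>ball x (e x). F (orbit H (sgn y)) = orbit G (Q x *v sgn y))"
    by metis
  define R where "R a b \<longleftrightarrow> (\<exists>g\<in>G. Q a = g ** Q b)" for a b
  have "connected (sphere (0 :: real ^ 'k) 1)"
    using dim by (intro connected_sphere) simp
  moreover have "\<exists>T. openin (top_of_set (sphere 0 1)) T \<and> a \<in> T \<and> (\<forall>b\<in>T. R a b)" if a: "a \<in> sphere 0 1" for a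
  proof (intro exI conjI ballI)
    show "openin (top_of_set (sphere 0 1)) (sphere 0 1 \<inter> ball a (e a))"
      by (intro openin_open_Int open_ball)
    show "a \<in> sphere 0 1 \<inter> ball a (e a)"
      using a Qe by simp
    fix b assume b: "b \<in> sphere 0 1 \<inter> ball a (e a)"
    \<comment> \<open>The origin is removed because it has no direction.\<close>
    let ?W = "ball a (e a) \<inter> ball b (e b) - {0}"
    have "b \<in> ?W"
      using b Qe by auto
    moreover have "open ?W"
      by (intro open_Diff open_Int open_ball) auto
    moreover have "orbit G (Q a *v y) = orbit G (Q b *v y)" if y: "y \<in> ?W" for y
    proof -
      have "orbit G (Q a *v sgn y) = orbit G (Q b *v sgn y)"
        using y Qe[OF a] Qe[of b] b by (metis Diff_iff IntD1 IntD2)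
      then obtain g where g: "g \<in> G" "Q b *v sgn y = g *v (Q a *v sgn y)"
        using free_rotation_group.orbit_eqD[OF G] by blast
      have "y = norm y *\<^sub>R sgn y"
        using y by (simp add: sgn_div_norm)
      then have "Q b *v y = g *v (Q a *v y)"
        using g(2) by (metis matrix_vector_mult_scaleR)
      then show ?thesis
        using free_rotation_group.orbit_move[OF G g(1)] by simp
    qed
    ultimately show "R a b"
      unfolding R_def by (intro free_rotation_group.orbit_eq_on_open_imp[OF G]) auto
  qed
  moreover have "R b a" if ab: "R a b" for a b
  proof -
    obtain g where g: "g \<in> G" "Q a = g ** Q b"
      using ab by (auto simp: R_def)
    then have "transpose g ** Q a = (transpose g ** g) ** Q b"
      by (simp add: matrix_mul_assoc)
    then have "Q b = transpose g ** Q a"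
      using orthogonal_matrix_cancel(2)[OF free_rotation_group.orth[OF G g(1)]] by simp
    then show ?thesis
      using free_rotation_group.transpose[OF G g(1)] by (auto simp: R_def)
  qed
  moreover have "R a c" if "R a b" "R b c" for a b c
    using that free_rotation_group.mult[OF G] unfolding R_def by (metis matrix_mul_assoc)
  ultimately have R: "R a b" if "a \<in> sphere 0 1" "b \<in> sphere 0 1" for a b
    using connected_equivalence_relation[of "sphere 0 1" a b R] that by blast
  obtain x0 :: "real ^ 'k" where x0: "x0 \<in> sphere 0 1"
    using vector_choose_size[of 1] by auto
  show ?thesis
  proof (rule that)
    show "orthogonal_matrix (Q x0)"
      using Qe[OF x0] by blast
    fix y :: "real ^ 'k" assume y: "norm y = 1"
    then have sy: "sgn y = y" "y \<in> sphere 0 1"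
      by (auto simp: sgn_div_norm)
    obtain g where g: "g \<in> G" "Q y = g ** Q x0"
      using R[OF sy(2) x0] by (auto simp: R_def)
    have "F (orbit H y) = orbit G (Q y *v y)"
      using Qe[OF sy(2)] sy(1) centre_in_ball by metis
    then show "F (orbit H y) = orbit G (Q x0 *v y)"
      by (simp add: g(2) free_rotation_group.orbit_move[OF G g(1)] flip: matrix_vector_mul_assoc)
  qed
qed

text \<open>
For \<open>h\<close> in \<open>H\<close> the matrices \<open>Q h\<close> and \<open>Q\<close> induce the same map, so they differ by an element of \<open>G\<close>;
injectivity of \<open>F\<close> gives the converse.
\<close>

lemma induced_linear_map_conjugates:
  assumes H: "free_rotation_group H" and G: "free_rotation_group G" and Q: "orthogonal_matrix Q"
    and F: "\<And>y. norm y = 1 \<Longrightarrow> F (orbit H y) = orbit G (Q *v y)"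
    and inj: "inj_on F (orbit H ` sphere 0 1)"
  shows "(\<lambda>A. Q ** A ** transpose Q) ` H = G"
proof -
  have scale: "orbit G' (A *v y) = orbit G' (B *v y)"
    if G': "free_rotation_group G'" and eq: "\<And>z. norm z = 1 \<Longrightarrow> orbit G' (A *v z) = orbit G' (B *v z)"
      and "y \<noteq> 0"
    for G' A B and y :: "real ^ 'a"
  proof -
    have "norm (sgn y) = 1"
      using that by (simp add: norm_sgn)
    then obtain g where g: "g \<in> G'" "B *v sgn y = g *v (A *v sgn y)"
      using free_rotation_group.orbit_eqD[OF G' eq] by blast
    have "y = norm y *\<^sub>R sgn y"
      using that by (simp add: sgn_div_norm)
    then have "B *v y = g *v (A *v y)"
      using g(2) by (metis matrix_vector_mult_scaleR)
    then show ?thesis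
      using free_rotation_group.orbit_move[OF G' g(1)] by simp
  qed
  have W: "open (- {0 :: real ^ 'a})" "- {0 :: real ^ 'a} \<noteq> {}"
    using vector_choose_size[of 1, where 'a = "real ^ 'a"] by fastforce+
  show ?thesis
  proof (intro equalityI subsetI)
    fix B assume "B \<in> (\<lambda>A. Q ** A ** transpose Q) ` H"
    then obtain h where h: "h \<in> H" "B = Q ** h ** transpose Q"
      by blast
    have "orbit G ((Q ** h) *v y) = orbit G (Q *v y)" if "norm y = 1" for y
    proof -
      have "orbit G (Q *v (h *v y)) = F (orbit H (h *v y))"
        using that by (intro F[symmetric]) (simp add: orthogonal_matrix_norm free_rotation_group.orth[OF H h(1)])
      also have "\<dots> = orbit G (Q *v y)"
        using that F by (simp add: free_rotation_group.orbit_move[OF H h(1)])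
      finally show ?thesis
        by (simp add: matrix_vector_mul_assoc)
    qed
    then obtain g where g: "g \<in> G" "Q ** h = g ** Q"
      using free_rotation_group.orbit_eq_on_open_imp[OF G W, of "Q ** h" Q] scale[OF G, of "Q ** h" Q] by blast
    then show "B \<in> G"
      using orthogonal_conjugation_iff[OF Q] h(2) by metis
  next
    fix g assume g: "g \<in> G"
    have "orbit H ((transpose Q ** g ** Q) *v y) = orbit H (mat 1 *v y)" if "norm y = 1" for y
    proof -
      have n: "norm ((transpose Q ** g ** Q) *v y) = 1"
        using that Q free_rotation_group.orth[OF G g]
        by (simp add: orthogonal_matrix_norm orthogonal_matrix_mul)
      have "F (orbit H ((transpose Q ** g ** Q) *v y)) = orbit G (Q *v ((transpose Q ** g ** Q) *v y))"
        by (rule F[OF n])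
      also have "Q *v ((transpose Q ** g ** Q) *v y) = g *v (Q *v y)"
        by (simp add: orthogonal_matrix_cancel[OF Q] flip: matrix_vector_mul_assoc)
      also have "orbit G (g *v (Q *v y)) = F (orbit H y)"
        using F[OF that] free_rotation_group.orbit_move[OF G g] by simp
      finally show ?thesis
        using inj_onD[OF inj, of "orbit H ((transpose Q ** g ** Q) *v y)" "orbit H y"] n that by simp
    qed
    then obtain h where h: "h \<in> H" "transpose Q ** g ** Q = h ** mat 1"
      using free_rotation_group.orbit_eq_on_open_imp[OF H W, of "transpose Q ** g ** Q" "mat 1"]
        scale[OF H, of "transpose Q ** g ** Q" "mat 1"] by blast
    then have "Q ** h ** transpose Q = (Q ** transpose Q) ** g ** (Q ** transpose Q)"
      by (simp add: matrix_mul_assoc[symmetric])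
        (simp add: matrix_mul_assoc h(2)[symmetric])
    then have "g = Q ** h ** transpose Q"
      by (simp add: orthogonal_matrix_cancel[OF Q])
    then show "g \<in> (\<lambda>A. Q ** A ** transpose Q) ` H"
      using h(1) by blast
  qed
qed

text \<open>
An induced map has the same orientation sign \<open>det Q\<close> in all charts, so one pair of charts with overlapping
images determines \<open>det Q\<close>.
\<close>

theorem eps_isometric_sphere_quotients_iff:
  fixes H G :: "(real ^ 'k ^ 'k) set"
  assumes dim: "2 \<le> CARD('k)" and H: "free_rotation_group H" and G: "free_rotation_group G"
    and \<epsilon>: "\<epsilon> \<in> {1, - 1}"
  shows "eps_isometric \<epsilon> (sphere_quotient H) (sphere_quotient G) \<longleftrightarrow>
    (\<exists>Q. orthogonal_matrix Q \<and> det Q = real_of_int \<epsilon> \<and> (\<lambda>A. Q ** A ** transpose Q) ` H = G)"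
    (is "_ \<longleftrightarrow> ?R")
proof -
  let ?M = "sphere_quotient H" and ?N = "sphere_quotient G"
  define oriented where "oriented F \<longleftrightarrow> (\<forall>c\<in>charts ?M. \<forall>c'\<in>charts ?N. \<forall>u\<in>coord_dom c c' F.
        orientation_sign (cnormal c) (cnormal c') (hderiv (cnormal c) (coord_map c c' F) u) = real_of_int \<epsilon>)" for F
  have "eps_isometric \<epsilon> ?M ?N \<longleftrightarrow> (\<exists>F. riemannian_isometry ?M ?N F \<and> oriented F)"
    using \<epsilon> unfolding eps_isometric_def orientation_preserving_def orientation_reversing_def oriented_def by auto
  also have "\<dots> \<longleftrightarrow> ?R"
  proof
    assume "\<exists>F. riemannian_isometry ?M ?N F \<and> oriented F"
    then obtain F where iso: "riemannian_isometry ?M ?N F" and o: "oriented F"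
      by blast
    obtain Q where Q: "orthogonal_matrix Q" and F: "\<And>y. norm y = 1 \<Longrightarrow> F (orbit H y) = orbit G (Q *v y)"
      using riemannian_isometry_linear[OF dim H G iso] by blast
    have "inj_on F (orbit H ` sphere 0 1)"
      using iso by (simp add: riemannian_isometry_def diffeomorphism_def bij_betw_def points_sphere_quotient)
    then have "(\<lambda>A. Q ** A ** transpose Q) ` H = G"
      using induced_linear_map_conjugates[OF H G Q F] by blast
    moreover obtain x :: "real ^ 'k" where x: "norm x = 1"
      using vector_choose_size[of 1] by auto
    obtain U where U: "chart_domain H x U" "0 \<in> U"
      by (rule free_rotation_group.chart_domain_exists[OF H x])
    have x': "norm (Q *v x) = 1"
      by (simp add: orthogonal_matrix_norm Q x)
    obtain U' where U': "chart_domain G (Q *v x) U'" "0 \<in> U'"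
      by (rule free_rotation_group.chart_domain_exists[OF G x'])
    have "0 \<in> coord_dom (sphere_chart H x U) (sphere_chart G (Q *v x) U') F"
      using x x' U(2) U'(2) F[OF x] by (rule zero_in_coord_dom)
    then have "det Q = real_of_int \<epsilon>"
      using free_rotation_group.orientation_sign_induced[OF G Q F U(1) U'(1)] o U(1) U'(1)
      unfolding oriented_def charts_sphere_quotient by fastforce
    ultimately show ?R
      using Q by blast
  next
    assume ?R
    then obtain Q where Q: "orthogonal_matrix Q" "det Q = real_of_int \<epsilon>" "(\<lambda>A. Q ** A ** transpose Q) ` H = G"
      by blast
    note iso = riemannian_isometry_induced[OF G H Q(1,3)]
    have "oriented ((`) ((*v) Q))"
      using free_rotation_group.orientation_sign_induced[OF G Q(1) iso(2)] Q(2)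
      unfolding oriented_def charts_sphere_quotient by fastforce
    then show "\<exists>F. riemannian_isometry ?M ?N F \<and> oriented F"
      using iso(1) by blast
  qed
  finally show ?thesis .
qed

section \<open>Isometries of lens spaces\<close>

theorem theorem2p6:
  fixes q :: nat and p s :: "'m::finite \<Rightarrow> int" and \<epsilon> :: int
  assumes "q \<ge> 1"
    and "\<And>i. gcd (int q) (p i) = 1"
    and "\<And>i. gcd (int q) (s i) = 1"
    and "\<epsilon> \<in> {1, - 1}"
  shows "eps_isometric \<epsilon> (lens_space q p) (lens_space q s) \<longleftrightarrow>
    (\<exists>(l::int) (\<sigma>::'m \<Rightarrow> 'm) (e::'m \<Rightarrow> int).
       \<sigma> permutes UNIV \<and>
       (\<forall>i. e i \<in> {1, - 1}) \<and>
       (\<forall>i. [l * p (\<sigma> i) * e (\<sigma> i) = s i] (mod int q)) \<and>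
       (\<Prod>i\<in>UNIV. e i) = \<epsilon>)"
    (is "_ \<longleftrightarrow> ?R")
proof -
  let ?H = "cyclic_group (lens_gen q p)" and ?G = "cyclic_group (lens_gen q s)"
  have "CARD('m) \<ge> 1"
    using zero_less_card_finite[where 'a = 'm] by linarith
  then have "2 \<le> CARD('m \<times> 2)"
    by simp
  then have "eps_isometric \<epsilon> (lens_space q p) (lens_space q s) \<longleftrightarrow>
      (\<exists>Q. orthogonal_matrix Q \<and> det Q = real_of_int \<epsilon> \<and> (\<lambda>A. Q ** A ** transpose Q) ` ?H = ?G)"
    unfolding lens_space_def
    using assms by (intro eps_isometric_sphere_quotients_iff lens_group_free)
  also have "\<dots> \<longleftrightarrow> ?R"
  proof
    assume "\<exists>Q. orthogonal_matrix Q \<and> det Q = real_of_int \<epsilon> \<and> (\<lambda>A. Q ** A ** transpose Q) ` ?H = ?G"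
    then obtain Q where Q: "orthogonal_matrix Q" "det Q = real_of_int \<epsilon>" "(\<lambda>A. Q ** A ** transpose Q) ` ?H = ?G"
      by blast
    have "\<exists>l \<sigma> e. \<sigma> permutes UNIV \<and> (\<forall>i. e i \<in> {1, - 1}) \<and>
        (\<forall>i. [l * p (\<sigma> i) * e (\<sigma> i) = s i] (mod int q)) \<and> det Q = real_of_int (\<Prod>i\<in>UNIV. e i)"
      using assms(1,3) Q(1,3) by (rule conjugate_imp_lens_congruences)
    then obtain l \<sigma> e where *: "\<sigma> permutes UNIV" "\<forall>i. e i \<in> {1, - 1}"
      "\<forall>i. [l * p (\<sigma> i) * e (\<sigma> i) = s i] (mod int q)" and "det Q = real_of_int (\<Prod>i\<in>UNIV. e i)"
      by blast
    then have "(\<Prod>i\<in>UNIV. e i) = \<epsilon>"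
      using Q(2) of_int_eq_iff by metis
    with * show ?R
      by blast
  next
    assume ?R
    then obtain l \<sigma> e where *: "\<sigma> permutes UNIV" "\<And>i. e i \<in> {1, - 1}"
      "\<And>i. [l * p (\<sigma> i) * e (\<sigma> i) = s i] (mod int q)" and \<epsilon>: "(\<Prod>i\<in>UNIV. e i) = \<epsilon>"
      by blast
    show "\<exists>Q. orthogonal_matrix Q \<and> det Q = real_of_int \<epsilon> \<and> (\<lambda>A. Q ** A ** transpose Q) ` ?H = ?G"
      unfolding \<epsilon>[symmetric] using assms(1,3) * by (rule lens_congruences_imp_conjugate)
  qed
  finally show ?thesis .
qed

end
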